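(* Let $P$ be any probability distribution on $\mathbb{R}^d$, let $X_1,\dots,X_n$ be i.i.d. with law $P$, and let $\delta\in(0,1)$. 1. If $\delta^{2d-1}\le 1/(17e^8)$ and $n\ge4$, then with probability larger than $1-\delta$, $$\sup_{x\in\mathbb{R}^d\setminus\{0\}}\big|\widehat{\mathrm{pD}}(x)-\mathrm{pD}(x;P)\big|\le\sqrt{\frac{d\log(n/\delta)}{n}}.$$ 2. For $t>0$ let $p_t=\mathbb{P}(\|X\|\ge t)$ where $X\sim P$, and assume $p_t>0$. If $(2\delta)^d\le1/8$, then with probability at least $1-\delta$, $$p_t^{-1}\sup_{x:\,\|x\|\ge t}\big|\widehat{\mathrm{pD}}(x)-\mathrm{pD}(x;P)\big|\le3\sqrt{\frac{d\log((np_t+1)/\delta)}{np_t}}+\frac23\,\frac{\log(1/\delta)}{np_t}.$$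
   Context: Let $d\ge2$, let $\langle\cdot,\cdot\rangle$ and $\|\cdot\|$ be the Euclidean inner product and norm on $\mathbb{R}^d$, $\mathbb{S}=\{z:\|z\|=1\}$, and $H_{0,u}=\{y:\langle y,u\rangle\ge0\}$ for $u\in\mathbb{S}$. The polar depth of $x\ne0$ relative to a probability measure $P$ on $\mathbb{R}^d$ is $\mathrm{pD}(x;P)=\inf\{P(\{y:\|y\|\ge\|x\|,\ y\in H_{0,u}\}):u\in\mathbb{S},\ x\in H_{0,u}\}$. The empirical polar depth is $\widehat{\mathrm{pD}}(x)=\mathrm{pD}(x;P_n)$ with $P_n=\frac1n\sum_{i=1}^n\delta_{X_i}$. *)

theory Defs
  imports "HOL-Probability.Probability"
begin

definition halfspace0 :: "real^'d \<Rightarrow> (real^'d) set" where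
  "halfspace0 u = {y. 0 \<le> y \<bullet> u}"

(* Only meaningful for x \<noteq> 0.  The infimum is a real infimum; the index set is nonempty
   (take u = x / norm x) and the values are nonnegative. *)
definition polar_depth :: "(real^'d) measure \<Rightarrow> real^'d \<Rightarrow> real" where
  "polar_depth P x =
     (INF u\<in>{u \<in> sphere 0 1. x \<in> halfspace0 u}.
        measure P {y. norm x \<le> norm y \<and> y \<in> halfspace0 u})"

definition empirical_measure :: "nat \<Rightarrow> (nat \<Rightarrow> 'a::topological_space) \<Rightarrow> 'a measure" where
  "empirical_measure n x =
     measure_of UNIV (sets borel)
       (\<lambda>A. (1 / of_nat n) * (\<Sum>i=1..n. emeasure (return borel (x i)) A))"

lemma sets_empirical_measure [simp, measurable_cong]:
  "sets (empirical_measure n x) = sets borel"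
  unfolding empirical_measure_def
  using sets.sigma_sets_eq[of "borel :: 'a::topological_space measure"] by simp

lemma space_empirical_measure [simp]: "space (empirical_measure n x) = UNIV"
  by (simp add: empirical_measure_def space_measure_of_conv)

lemma emeasure_empirical_measure:
  assumes "A \<in> sets borel"
  shows "emeasure (empirical_measure n x) A =
     (1 / of_nat n) * (\<Sum>i=1..n. emeasure (return borel (x i)) A)"
proof (rule emeasure_measure_of[OF empirical_measure_def])
  show "countably_additive (sets (empirical_measure n x))
     (\<lambda>A. (1 / of_nat n) * (\<Sum>i=1..n. emeasure (return borel (x i)) A))"
    unfolding countably_additive_def
  proof (intro allI impI)
    fix B :: "nat \<Rightarrow> 'a set"
    assume B: "range B \<subseteq> sets (empirical_measure n x)" "disjoint_family B"
    have "(\<Sum>j. \<Sum>i=1..n. emeasure (return borel (x i)) (B j)) =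
        (\<Sum>i=1..n. \<Sum>j. emeasure (return borel (x i)) (B j))"
      by (rule suminf_sum) simp
    also have "\<dots> = (\<Sum>i=1..n. emeasure (return borel (x i)) (\<Union>j. B j))"
      by (intro sum.cong refl suminf_emeasure) (use B in auto)
    finally show "(\<Sum>j. (1 / of_nat n) * (\<Sum>i=1..n. emeasure (return borel (x i)) (B j))) =
        (1 / of_nat n) * (\<Sum>i=1..n. emeasure (return borel (x i)) (\<Union>j. B j))"
      by (simp only: ennreal_suminf_cmult)
  qed
qed (use assms in \<open>auto simp: positive_def\<close>)

lemma measure_empirical_measure:
  assumes "n \<ge> 1" "A \<in> sets borel"
  shows "measure (empirical_measure n x) A = real (card {i\<in>{1..n}. x i \<in> A}) / real n"
proof -
  have "(\<Sum>i=1..n. emeasure (return borel (x i)) A) = (\<Sum>i=1..n. ennreal (indicator A (x i)))"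
    using assms(2) by (intro sum.cong) (auto simp: indicator_def)
  also have "\<dots> = ennreal (\<Sum>i=1..n. indicator A (x i))"
    by (rule sum_ennreal) simp
  also have "(\<Sum>i=1..n. indicator A (x i) :: real) = real (card {i\<in>{1..n}. x i \<in> A})"
    by (simp add: indicator_def sum.If_cases Int_def)
  finally have "emeasure (empirical_measure n x) A =
      (1 / of_nat n) * ennreal (real (card {i\<in>{1..n}. x i \<in> A}))"
    using assms(2) by (simp add: emeasure_empirical_measure)
  also have "\<dots> = ennreal (1 / real n) * ennreal (real (card {i\<in>{1..n}. x i \<in> A}))"
    using assms(1) by (subst divide_ennreal[symmetric]) (auto simp: ennreal_of_nat_eq_real_of_nat)
  also have "\<dots> = ennreal (real (card {i\<in>{1..n}. x i \<in> A}) / real n)"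
    by (subst ennreal_mult[symmetric]) auto
  finally show ?thesis by (simp add: measure_def)
qed

end

theory Submission imports Defs begin

text \<open>The polar depth of \<open>x\<close> is an infimum of measures of the caps
  \<open>{y. norm x \<le> norm y \<and> 0 \<le> y \<bullet> u}\<close>, and by semicontinuity countably many caps suffice. On
  \<open>N\<close> points the caps leave at most \<open>3 N ^ d + 1\<close> traces, so Devroye's inequality (ghost
  sample of size \<open>n\<^sup>2 - n\<close>, then sampling without replacement) bounds the deviation uniformly over
  them; this is the first part.

  For the second part let \<open>m = n p\<close> be the expected number of points in the tail
  \<open>norm y \<ge> t\<close> and \<open>L = ln ((m + 1) / \<delta>)\<close>. If \<open>m \<le> 4 d L\<close>, a violation forces
  the number of tail points to be so large that Bernstein's inequality applies. Otherwise Bernstein's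
  inequality puts the number of tail points close to \<open>m\<close>, and conditionally on which points lie in
  the tail, these are independent with the conditional law, to which Devroye's inequality applies.\<close>

section \<open>Traces of the polar half-spaces\<close>

text \<open>With \<open>n\<^sup>2 - n\<close> further points every probability is estimated to
  within \<open>1 / n\<close>, which is below the deviation \<open>e\<close> under test. Centring at
  the pooled frequency then costs only \<open>4 * e + 4 * e\<^sup>2\<close> in the exponent, and the
  leading term \<open>- 2 * n * e\<^sup>2\<close> keeps Hoeffding's constant. The price is
  \<open>n ^ (2 * d)\<close> traces. At the deviation of the first bound the exponential is
  \<open>(\<delta> / n) ^ (2 * d)\<close> and cancels that power; what remains is
  \<open>17 * exp 8 * \<delta> ^ (2 * d)\<close>, hence the condition on \<open>\<delta>\<close>.

  The second bound scales with the tail probability, which a bound over all \<open>n\<close> points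
  cannot see. Conditioning brings the effective sample size down to about \<open>m\<close>, but the
  number of tail points is random and its fluctuation is paid additively: of the factor 3, Devroye's
  inequality receives 9/5 and the count the rest.

  A last obstacle is measurability. The supremum runs over uncountably many points, and
  \<open>measure\<close> is 0 on sets that are not events, so a lower bound for the probability
  needs the deviation event itself to be measurable, not just to contain the good event of countably
  many caps.\<close>

lemma card_insert_traces:
  assumes "finite F" "i \<notin> F" "finite S" "\<And>s. s \<in> S \<Longrightarrow> s \<subseteq> insert i F"
  shows "card S = card ((\<lambda>s. s - {i}) ` S) + card {s \<in> Pow F. s \<in> S \<and> insert i s \<in> S}"
proof -
  let ?S1 = "{s\<in>S. i \<in> s}" and ?S0 = "{s\<in>S. i \<notin> s}"
  have inj1: "inj_on (\<lambda>s. s - {i}) ?S1" by (auto simp: inj_on_def)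
  have im1: "card ((\<lambda>s. s - {i}) ` ?S1) = card ?S1" by (rule card_image[OF inj1])
  have "card S = card ?S1 + card ?S0"
    using assms(3) by (subst card_Un_disjoint[symmetric]) (auto intro!: arg_cong[where f=card])
  also have "\<dots> = card ((\<lambda>s. s - {i}) ` ?S1) + card ?S0" by (simp only: im1)
  \<comment> \<open>The union consists of all traces with \<open>i\<close> removed, the intersection
    of the traces on \<open>F\<close> that occur both with and without \<open>i\<close>; the two
    sizes add up to \<open>card S\<close>.\<close>
  also have "\<dots> = card ((\<lambda>s. s - {i}) ` ?S1 \<union> ?S0) + card ((\<lambda>s. s - {i}) ` ?S1 \<inter> ?S0)"
    using assms(3) by (intro card_Un_Int) auto
  also have "?S0 = (\<lambda>s. s - {i}) ` ?S0" by (auto simp: image_iff)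
  also have "(\<lambda>s. s - {i}) ` ?S1 \<union> (\<lambda>s. s - {i}) ` ?S0 = (\<lambda>s. s - {i}) ` S"
    unfolding image_Un[symmetric] by (rule arg_cong[where f = "image _"]) blast
  also have "(\<lambda>s. s - {i}) ` ?S1 \<inter> (\<lambda>s. s - {i}) ` ?S0 = {s \<in> Pow F. s \<in> S \<and> insert i s \<in> S}"
  proof (intro equalityI subsetI)
    fix s assume "s \<in> (\<lambda>s. s - {i}) ` ?S1 \<inter> (\<lambda>s. s - {i}) ` ?S0"
    then obtain a b where a: "a \<in> S" "i \<in> a" "s = a - {i}" and b: "b \<in> S" "i \<notin> b" "s = b - {i}"
      by auto
    then have "s = b" "insert i s = a" by auto
    then show "s \<in> {s \<in> Pow F. s \<in> S \<and> insert i s \<in> S}" using a b assms(4)[of b] by auto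
  next
    fix s assume s: "s \<in> {s \<in> Pow F. s \<in> S \<and> insert i s \<in> S}"
    then have "s = insert i s - {i}" "s = s - {i}" using assms(2) by auto
    then show "s \<in> (\<lambda>s. s - {i}) ` ?S1 \<inter> (\<lambda>s. s - {i}) ` ?S0"
      using s assms(2) by (intro IntI image_eqI[of _ _ "insert i s"] image_eqI[of _ _ s]) auto
  qed
  finally show ?thesis .
qed

lemma subspace_dim_le_1:
  fixes V :: "'a::euclidean_space set"
  assumes "dim V \<le> Suc 0"
  obtains v where "V \<subseteq> range (\<lambda>c. c *\<^sub>R v)"
proof -
  obtain B where B: "B \<subseteq> V" "independent B" "V \<subseteq> span B" "card B = dim V"
    using basis_exists by blast
  have "\<exists>v. B \<subseteq> {v}"
  proof (cases "dim V")
    case 0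
    then have "card B = 0" using B(4) by (simp only:)
    then have "B = {}" using independent_imp_finite[OF B(2)] by simp
    then show ?thesis by simp
  next
    case (Suc m)
    then have "card B = 1" using B assms by simp
    then show ?thesis by (auto simp: card_1_singleton_iff)
  qed
  then obtain v where "B \<subseteq> {v}" by blast
  then have "V \<subseteq> span {v}" using B(3) span_mono by blast
  then show ?thesis using that by (simp add: span_singleton)
qed

text \<open>If two points of the subspace separate an additional vector but have equal traces on the old
  ones, then a convex combination orthogonal to the additional vector again has that trace. This
  yields the recursion \<open>T(k + 1, N + 1) \<le> T(k + 1, N) + T(k, N)\<close>.\<close>

lemma card_halfspace_traces_le:
  fixes V :: "'a::euclidean_space set" and y :: "'i \<Rightarrow> 'a"
  assumes "finite I" "I \<noteq> {}" "subspace V" "dim V \<le> Suc k"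
  shows "card ((\<lambda>u. {i\<in>I. 0 \<le> y i \<bullet> u}) ` V) \<le> 3 * card I ^ k"
  using assms
proof (induction k arbitrary: V I)
  case 0
  obtain v where v: "V \<subseteq> range (\<lambda>c. c *\<^sub>R v)" using subspace_dim_le_1 0 by blast
  \<comment> \<open>On a line the trace depends only on the sign of the scalar \<open>c\<close>, and
    \<open>c = 0\<close> selects all of \<open>I\<close>: this is the factor 3.\<close>
  have "(\<lambda>u. {i\<in>I. 0 \<le> y i \<bullet> u}) ` V \<subseteq> {{i\<in>I. 0 \<le> y i \<bullet> v}, {i\<in>I. y i \<bullet> v \<le> 0}, I}"
  proof
    fix s assume "s \<in> (\<lambda>u. {i\<in>I. 0 \<le> y i \<bullet> u}) ` V"
    then obtain c where s: "s = {i\<in>I. 0 \<le> c * (y i \<bullet> v)}" using v by fastforce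
    consider "c > 0" | "c < 0" | "c = 0" by linarith
    then show "s \<in> {{i\<in>I. 0 \<le> y i \<bullet> v}, {i\<in>I. y i \<bullet> v \<le> 0}, I}"
      by cases (simp_all add: s zero_le_mult_iff)
  qed
  then have "card ((\<lambda>u. {i\<in>I. 0 \<le> y i \<bullet> u}) ` V)
      \<le> card {{i\<in>I. 0 \<le> y i \<bullet> v}, {i\<in>I. y i \<bullet> v \<le> 0}, I}"
    by (intro card_mono) auto
  also have "\<dots> \<le> 3" by (simp add: card_insert_if)
  finally show ?case by simp
next
  case (Suc k)
  note IHk = Suc.IH
  show ?case using Suc.prems(1,2)
  proof (induction I rule: finite_ne_induct)
    case (singleton i)
    have "(\<lambda>u. {j\<in>{i}. 0 \<le> y j \<bullet> u}) ` V \<subseteq> {{}, {i}}" by auto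
    then have "card ((\<lambda>u. {j\<in>{i}. 0 \<le> y j \<bullet> u}) ` V) \<le> card {{}, {i}}"
      by (intro card_mono) auto
    then show ?case by simp
  next
    case (insert i F)
    let ?f = "\<lambda>I u. {j\<in>I. 0 \<le> y j \<bullet> u}"
    let ?S = "?f (insert i F) ` V"
    let ?D = "{s \<in> Pow F. s \<in> ?S \<and> insert i s \<in> ?S}"
    let ?W = "V \<inter> {u. y i \<bullet> u = 0}"
    have fin: "finite ?S"
      by (rule finite_subset[of _ "Pow (insert i F)"]) (use insert in auto)
    have card: "card ?S = card ((\<lambda>s. s - {i}) ` ?S) + card ?D"
      by (rule card_insert_traces) (use insert fin in auto)
    have "(\<lambda>s. s - {i}) ` ?S = ?f F ` V"
      unfolding image_image using insert(3) by (intro image_cong) auto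
    then have c1: "card ((\<lambda>s. s - {i}) ` ?S) \<le> 3 * card F ^ Suc k" using insert.IH by simp
    have c2: "card ?D \<le> 3 * card F ^ k"
    proof (cases "?D = {}")
      case False
      have D: "?D \<subseteq> ?f F ` ?W"
      proof
        fix s assume "s \<in> ?D"
        then obtain u w where u: "u \<in> V" "s = ?f (insert i F) u"
          and w: "w \<in> V" "insert i s = ?f (insert i F) w" and s: "s \<subseteq> F" by auto
        have i: "y i \<bullet> u < 0" "y i \<bullet> w \<ge> 0" using u w s insert(3) by auto
        \<comment> \<open>The weights make \<open>a *\<^sub>R u + b *\<^sub>R w\<close> orthogonal
          to \<open>y i\<close>. Only \<open>b\<close> is known to be nonzero, so outside
          \<open>s\<close> strict negativity has to come from \<open>w\<close>, whose trace is
          \<open>insert i s\<close>.\<close>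
        define a b where "a = y i \<bullet> w" and "b = - (y i \<bullet> u)"
        have ab: "a \<ge> 0" "b > 0" using i by (auto simp: a_def b_def)
        have "a *\<^sub>R u + b *\<^sub>R w \<in> ?W"
          using u(1) w(1) Suc.prems(3)
          by (auto simp: subspace_diff subspace_scale inner_diff_right a_def b_def)
        moreover have "?f F (a *\<^sub>R u + b *\<^sub>R w) = s"
        proof -
          have "0 \<le> y j \<bullet> (a *\<^sub>R u + b *\<^sub>R w) \<longleftrightarrow> j \<in> s" if "j \<in> F" for j
          proof (cases "j \<in> s")
            case True
            then have "0 \<le> y j \<bullet> u" "0 \<le> y j \<bullet> w" using u w by auto
            then show ?thesis using True ab by (simp add: inner_add_right)
          next
            case False
            then have "y j \<bullet> u < 0" "j \<notin> insert i s" using u that insert(3) by auto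
            then have "y j \<bullet> u < 0" "y j \<bullet> w < 0" using w that by auto
            then have "a * (y j \<bullet> u) \<le> 0" "b * (y j \<bullet> w) < 0"
              using ab by (auto simp: mult_nonneg_nonpos mult_pos_neg)
            then show ?thesis using False by (simp add: inner_add_right)
          qed
          then show ?thesis using s by auto
        qed
        ultimately show "s \<in> ?f F ` ?W" by blast
      qed
      \<comment> \<open>A member of \<open>?D\<close> is the trace of some \<open>u\<close> in
        \<open>V\<close> that omits \<open>i\<close>, so \<open>u\<close> is not orthogonal to
        \<open>y i\<close>; hence \<open>?W\<close> is a proper subspace and its dimension
        drops.\<close>
      from False obtain s where "s \<in> Pow F" "insert i s \<in> ?S" "s \<in> ?S" by blast
      then obtain u where u: "u \<in> V" "s = ?f (insert i F) u" by blast
      moreover have "i \<notin> s" using \<open>s \<in> Pow F\<close> insert(3) by blast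
      ultimately have "y i \<bullet> u \<noteq> 0" by auto
      have "subspace ?W"
        using Suc.prems(3) by (intro subspace_inter) (auto simp: subspace_hyperplane)
      then have "span ?W = ?W" "span V = V"
        using Suc.prems(3) by (simp_all only: span_eq_iff)
      moreover have "?W \<subset> V" using u \<open>y i \<bullet> u \<noteq> 0\<close> by blast
      ultimately have "dim ?W < dim V" by (intro dim_psubset) (simp only:)
      then have "dim ?W \<le> Suc k" using Suc.prems(4) by simp
      then have "card (?f F ` ?W) \<le> 3 * card F ^ k"
        by (rule IHk[OF insert(1,2) \<open>subspace ?W\<close>])
      moreover have "card ?D \<le> card (?f F ` ?W)"
      proof (rule card_mono[OF _ D])
        show "finite (?f F ` ?W)"
          by (rule finite_subset[of _ "Pow F"]) (use insert in auto)
      qed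
      ultimately show ?thesis by linarith
    qed (simp only: card.empty)
    have "card F ^ Suc k + card F ^ k = card (insert i F) * card F ^ k"
      using insert by (simp add: algebra_simps)
    also have "\<dots> \<le> card (insert i F) * card (insert i F) ^ k"
      using insert by (intro mult_left_mono power_mono) auto
    finally have "card F ^ Suc k + card F ^ k \<le> card (insert i F) ^ Suc k" by simp
    then show ?case using card c1 c2 by linarith
  qed
qed

text \<open>A radius matters only through the shortest point \<open>y j\<close> that it admits. This
  leaves \<open>card I\<close> families of half-space traces, each of size at most
  \<open>3 * card I ^ (DIM('a) - 1)\<close>, and one empty trace when no point is long
  enough.\<close>

lemma card_polar_traces_le:
  fixes y :: "'i \<Rightarrow> 'a::euclidean_space"
  assumes "finite I"
  shows "card ((\<lambda>(r, u). {i\<in>I. r \<le> norm (y i) \<and> 0 \<le> y i \<bullet> u}) ` UNIV) \<le> 3 * card I ^ DIM('a) + 1"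
proof -
  define d where "d = DIM('a) - 1"
  have d: "DIM('a) = Suc d" using DIM_positive[where 'a='a] by (simp add: d_def)
  define J where "J = (\<lambda>j. {i\<in>I. norm (y j) \<le> norm (y i)})"
  define T where "T = (\<lambda>j. (\<lambda>u. {i\<in>J j. 0 \<le> y i \<bullet> u}) ` UNIV)"
  have J: "finite (J j)" "J j \<subseteq> I" for j using assms by (auto simp: J_def)
  have fin: "finite (T j)" for j
    by (rule finite_subset[of _ "Pow (J j)"]) (use J in \<open>auto simp: T_def\<close>)
  have "(\<lambda>(r, u). {i\<in>I. r \<le> norm (y i) \<and> 0 \<le> y i \<bullet> u}) ` UNIV \<subseteq> insert {} (\<Union>j\<in>I. T j)"
  proof
    fix s assume "s \<in> (\<lambda>(r, u). {i\<in>I. r \<le> norm (y i) \<and> 0 \<le> y i \<bullet> u}) ` UNIV"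
    then obtain r u where s: "s = {i\<in>I. r \<le> norm (y i) \<and> 0 \<le> y i \<bullet> u}" by auto
    show "s \<in> insert {} (\<Union>j\<in>I. T j)"
    proof (cases "{i\<in>I. r \<le> norm (y i)} = {}")
      case False
      define j where "j = arg_min_on (\<lambda>i. norm (y i)) {i\<in>I. r \<le> norm (y i)}"
      have "j \<in> {i\<in>I. r \<le> norm (y i)}"
        "\<And>i. i \<in> {i\<in>I. r \<le> norm (y i)} \<Longrightarrow> norm (y j) \<le> norm (y i)"
        using arg_min_if_finite[of "{i\<in>I. r \<le> norm (y i)}" "\<lambda>i. norm (y i)"] assms False
        unfolding j_def[symmetric] by (simp_all add: not_less)
      then have "j \<in> I" "{i\<in>I. r \<le> norm (y i)} = J j" by (auto simp: J_def)
      then show ?thesis by (auto simp: s T_def)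
    qed (auto simp: s)
  qed
  then have "card ((\<lambda>(r, u). {i\<in>I. r \<le> norm (y i) \<and> 0 \<le> y i \<bullet> u}) ` UNIV)
      \<le> card (insert {} (\<Union>j\<in>I. T j))"
    using assms fin by (intro card_mono) auto
  also have "\<dots> \<le> 1 + (\<Sum>j\<in>I. card (T j))"
    using card_insert_le_m1[of "card (\<Union>j\<in>I. T j) + 1" "\<Union>j\<in>I. T j" "{}"] card_UN_le[OF assms, of T]
    by simp
  also have "(\<Sum>j\<in>I. card (T j)) \<le> (\<Sum>j\<in>I. 3 * card I ^ d)"
  proof (intro sum_mono)
    fix j assume "j \<in> I"
    then have "card (T j) \<le> 3 * card (J j) ^ d"
      unfolding T_def by (intro card_halfspace_traces_le J) (auto simp: J_def d)
    also have "\<dots> \<le> 3 * card I ^ d"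
      using J assms by (intro mult_left_mono power_mono card_mono) auto
    finally show "card (T j) \<le> 3 * card I ^ d" .
  qed
  also have "1 + (\<Sum>j\<in>I. 3 * card I ^ d) = 3 * card I ^ DIM('a) + 1"
    by (simp add: d)
  finally show ?thesis by simp
qed

section \<open>Sampling without replacement\<close>

text \<open>Each further factor of \<open>(k choose j) / (N choose j)\<close> is
  \<open>(k - j) / (N - j)\<close>, which is at most \<open>k / N\<close>. The form without division
  is also true for \<open>j > k\<close>, where truncated subtraction makes the left side
  vanish.\<close>

lemma binomial_ratio_le_power:
  assumes "k \<le> N"
  shows "(k choose j) * N ^ j \<le> (N choose j) * k ^ j"
proof (induction j)
  case (Suc j)
  have absorb: "Suc j * (m choose Suc j) = (m - j) * (m choose j)" for m
    by (simp only: binomial_absorption binomial_absorb_comp)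
  have absorb': "Suc j * ((m choose Suc j) * x ^ Suc j) = ((m choose j) * x ^ j) * ((m - j) * x)" for m x
  proof -
    have "Suc j * ((m choose Suc j) * x ^ Suc j) = (Suc j * (m choose Suc j)) * x ^ Suc j"
      by (simp only: mult.assoc)
    then show ?thesis by (simp only: absorb power_Suc mult_ac)
  qed
  have "(k - j) * N \<le> (N - j) * k"
    unfolding diff_mult_distrib mult.commute[of N k]
    by (intro diff_le_mono2 mult_le_mono2 assms)
  then have "((k choose j) * N ^ j) * ((k - j) * N) \<le> ((N choose j) * k ^ j) * ((N - j) * k)"
    by (rule mult_le_mono[OF Suc.IH])
  then have "Suc j * ((k choose Suc j) * N ^ Suc j) \<le> Suc j * ((N choose Suc j) * k ^ Suc j)"
    by (simp only: absorb')
  then show ?case by (simp only: Suc_mult_le_cancel1)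
qed simp

lemma sum_Pow_card:
  fixes f :: "nat \<Rightarrow> 'b::semiring_1"
  assumes "finite K"
  shows "(\<Sum>J\<in>Pow K. f (card J)) = (\<Sum>j\<le>card K. of_nat (card K choose j) * f j)"
proof -
  have "(\<Sum>J\<in>Pow K. f (card J)) = (\<Sum>j\<le>card K. \<Sum>J\<in>{J\<in>Pow K. card J = j}. f (card J))"
    using assms by (intro sum.group[symmetric]) (auto intro: card_mono)
  also have "\<dots> = (\<Sum>j\<le>card K. of_nat (card K choose j) * f j)"
    using assms by (intro sum.cong) (simp_all add: n_subsets[symmetric] Pow_def)
  finally show ?thesis .
qed

lemma card_supersets:
  assumes "finite U" "J \<subseteq> U" "card J \<le> n"
  shows "card {I. J \<subseteq> I \<and> I \<subseteq> U \<and> card I = n} = (card U - card J) choose (n - card J)"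
proof -
  have fin: "finite J" using assms finite_subset by blast
  have "bij_betw (\<lambda>I. I \<union> J) {I. I \<subseteq> U - J \<and> card I = n - card J} {I. J \<subseteq> I \<and> I \<subseteq> U \<and> card I = n}"
  proof (rule bij_betw_byWitness[where f' = "\<lambda>I. I - J"])
    show "(\<lambda>I. I \<union> J) ` {I. I \<subseteq> U - J \<and> card I = n - card J} \<subseteq> {I. J \<subseteq> I \<and> I \<subseteq> U \<and> card I = n}"
    proof clarify
      fix I assume I: "I \<subseteq> U - J" "card I = n - card J"
      then have "finite I" using assms(1) finite_subset by (metis finite_Diff)
      then have "card (I \<union> J) = card I + card J" using I fin by (intro card_Un_disjoint) auto
      then show "J \<subseteq> I \<union> J \<and> I \<union> J \<subseteq> U \<and> card (I \<union> J) = n" using I assms by auto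
    qed
    show "(\<lambda>I. I - J) ` {I. J \<subseteq> I \<and> I \<subseteq> U \<and> card I = n} \<subseteq> {I. I \<subseteq> U - J \<and> card I = n - card J}"
      using fin by (auto simp: card_Diff_subset)
  qed auto
  then have "card {I. J \<subseteq> I \<and> I \<subseteq> U \<and> card I = n} = card {I. I \<subseteq> U - J \<and> card I = n - card J}"
    by (simp add: bij_betw_same_card)
  then show ?thesis
    using assms fin by (simp add: n_subsets card_Diff_subset)
qed

text \<open>The moment generating function of the hypergeometric distribution is at most that of the
  binomial distribution, since \<open>(k choose j) / (N choose j) \<le> (k / N) ^ j\<close>.\<close>

lemma sum_subsets_power_card_le:
  fixes z :: real
  assumes U: "finite U" and K: "K \<subseteq> U" and n: "n \<le> card U" and z: "z \<ge> 0"
  shows "(\<Sum>I | I \<subseteq> U \<and> card I = n. (1 + z) ^ card (I \<inter> K))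
    \<le> (card U choose n) * (1 + z * (card K / card U)) ^ n"
proof (cases "card U = 0")
  case True
  then have "U = {}" using U by simp
  moreover from this have "K = {}" using K by simp
  moreover have "{I. I \<subseteq> U \<and> card I = n} = {{}}" using \<open>U = {}\<close> n by auto
  ultimately show ?thesis using n by (simp only:) simp
next
  case False
  define N where "N = card U"
  define k where "k = card K"
  have N: "N > 0" using False by (simp add: N_def)
  have finK: "finite K" using U K finite_subset by blast
  have kN: "k \<le> N" unfolding k_def N_def using U K by (rule card_mono)
  let ?S = "{I. I \<subseteq> U \<and> card I = n}"
  have finS: "finite ?S" by (rule finite_subset[of _ "Pow U"]) (use U in auto)
  \<comment> \<open>The binomial theorem as a sum over subsets. After exchanging the two sums, each
    \<open>J\<close> contained in \<open>K\<close> is weighted by the number of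
    \<open>n\<close>-subsets that contain it.\<close>
  have pow: "(1 + z) ^ card A = (\<Sum>J\<in>Pow A. z ^ card J)" if "finite A" for A :: "'a set"
    using sum_Pow_card[OF that, of "\<lambda>j. z ^ j"] binomial_ring[of z 1 "card A"]
    by (simp add: add.commute)
  have "(\<Sum>I\<in>?S. (1 + z) ^ card (I \<inter> K)) = (\<Sum>I\<in>?S. \<Sum>J\<in>Pow K. if J \<subseteq> I then z ^ card J else 0)"
  proof (intro sum.cong refl)
    fix I
    have "{J \<in> Pow K. J \<subseteq> I} = Pow (I \<inter> K)" by auto
    then show "(1 + z) ^ card (I \<inter> K) = (\<Sum>J\<in>Pow K. if J \<subseteq> I then z ^ card J else 0)"
      using finK by (simp add: pow sum.inter_filter[symmetric])
  qed
  also have "\<dots> = (\<Sum>J\<in>Pow K. \<Sum>I\<in>?S. if J \<subseteq> I then z ^ card J else 0)"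
    by (rule sum.swap)
  also have "\<dots> = (\<Sum>J\<in>Pow K. real (if card J \<le> n then (N - card J) choose (n - card J) else 0) * z ^ card J)"
  proof (intro sum.cong refl)
    fix J assume "J \<in> Pow K"
    then have J: "J \<subseteq> U" using K by auto
    have "(\<Sum>I\<in>?S. if J \<subseteq> I then z ^ card J else 0) = (\<Sum>I\<in>{I\<in>?S. J \<subseteq> I}. z ^ card J)"
      by (rule sum.inter_filter[OF finS, symmetric])
    also have "\<dots> = real (card {I. J \<subseteq> I \<and> I \<subseteq> U \<and> card I = n}) * z ^ card J"
      by (simp add: conj_ac)
    also have "card {I. J \<subseteq> I \<and> I \<subseteq> U \<and> card I = n} = (if card J \<le> n then (N - card J) choose (n - card J) else 0)"
    proof (cases "card J \<le> n")
      case True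
      then show ?thesis using card_supersets[OF U J True] by (simp add: N_def)
    next
      case False
      have "card J \<le> card I" if "J \<subseteq> I" "I \<subseteq> U" for I
        using that U by (meson card_mono finite_subset)
      then have "{I. J \<subseteq> I \<and> I \<subseteq> U \<and> card I = n} = {}" using False by fastforce
      then show ?thesis using False by (simp only: card.empty if_False)
    qed
    finally show "(\<Sum>I\<in>?S. if J \<subseteq> I then z ^ card J else 0)
      = real (if card J \<le> n then (N - card J) choose (n - card J) else 0) * z ^ card J" .
  qed
  also have "\<dots> = (\<Sum>j\<le>k. real (k choose j) * (real (if j \<le> n then (N - j) choose (n - j) else 0) * z ^ j))"
    unfolding k_def
    by (rule sum_Pow_card[OF finK, where f = "\<lambda>j. real (if j \<le> n then (N - j) choose (n - j) else 0) * z ^ j"])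
  also have "\<dots> \<le> (\<Sum>j\<le>k. if j \<le> n then (N choose n) * ((n choose j) * (z * (k / N)) ^ j) else 0)"
  proof (intro sum_mono)
    fix j assume j: "j \<in> {..k}"
    show "real (k choose j) * (real (if j \<le> n then (N - j) choose (n - j) else 0) * z ^ j)
      \<le> (if j \<le> n then (N choose n) * ((n choose j) * (z * (k / N)) ^ j) else 0)"
    proof (cases "j \<le> n")
      case True
      have "(N choose n) * (n choose j) = (N choose j) * ((N - j) choose (n - j))"
        using True n by (intro choose_mult) (auto simp: N_def)
      then have cm: "real (N choose n) * real (n choose j) = real (N choose j) * real ((N - j) choose (n - j))"
        by (metis of_nat_mult)
      have "real (k choose j) * real N ^ j \<le> real (N choose j) * real k ^ j"
        using binomial_ratio_le_power[OF kN, of j] by (metis of_nat_le_iff of_nat_mult of_nat_power)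
      then have "real (k choose j) \<le> real (N choose j) * (k / N) ^ j"
        using N by (simp add: power_divide field_simps)
      then have "real (k choose j) * (real ((N - j) choose (n - j)) * z ^ j)
          \<le> (real (N choose j) * (k / N) ^ j) * (real ((N - j) choose (n - j)) * z ^ j)"
        using z by (intro mult_right_mono) auto
      also have "\<dots> = (real (N choose j) * real ((N - j) choose (n - j))) * (z * (k / N)) ^ j"
        unfolding power_mult_distrib by (simp only: mult_ac)
      also have "\<dots> = (N choose n) * ((n choose j) * (z * (k / N)) ^ j)"
        unfolding cm[symmetric] by (simp only: mult_ac)
      finally show ?thesis using True by simp
    qed simp
  qed
  also have "\<dots> = (\<Sum>j\<in>{..k} \<inter> {..n}. (N choose n) * ((n choose j) * (z * (k / N)) ^ j))"
    by (subst sum.inter_restrict) auto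
  also have "\<dots> \<le> (\<Sum>j\<le>n. (N choose n) * ((n choose j) * (z * (k / N)) ^ j))"
    using z by (intro sum_mono2) auto
  also have "\<dots> = (N choose n) * (1 + z * (k / N)) ^ n"
    using binomial_ring[of "z * (k / N)" 1 n] by (simp add: sum_distrib_left add.commute)
  finally show ?thesis by (simp add: N_def k_def)
qed

text \<open>Hoeffding's lemma for a Bernoulli variable, whose moment generating function is
  \<open>1 + p * (exp h - 1)\<close>.\<close>

lemma Hoeffding_bernoulli:
  fixes h p :: real
  assumes "h \<ge> 0" "p \<ge> 0"
  shows "1 + p * (exp h - 1) \<le> exp (h * p + h\<^sup>2 / 8)"
proof -
  have pos: "1 + p * (exp h - 1) > 0"
    using assms by (smt (verit) mult_nonneg_nonneg one_le_exp_iff)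
  have "ln (1 + p * (exp h - 1)) \<le> h * p + h\<^sup>2 / 8"
    using Hoeffdings_lemma_aux[OF assms] by simp
  then have "exp (ln (1 + p * (exp h - 1))) \<le> exp (h * p + h\<^sup>2 / 8)" by simp
  then show ?thesis using pos by simp
qed

lemma card_subsets_deviation_ge:
  fixes \<eta> :: real
  assumes U: "finite U" and K: "K \<subseteq> U" and n: "n \<le> card U" and eta: "\<eta> \<ge> 0"
  shows "card {I. I \<subseteq> U \<and> card I = n \<and> n * (card K / card U) + n * \<eta> \<le> card (I \<inter> K)}
    \<le> (card U choose n) * exp (- 2 * real n * \<eta>\<^sup>2)"
proof -
  define p where "p = card K / card U"
  \<comment> \<open>Markov's inequality for \<open>exp (h * card (I \<inter> K))\<close> leaves the
    exponent \<open>n * (h\<^sup>2 / 8 - h * \<eta>)\<close>, which is least at this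
    \<open>h\<close>.\<close>
  define h where "h = 4 * \<eta>"
  have h: "h \<ge> 0" and p: "p \<ge> 0" using eta by (auto simp: h_def p_def)
  let ?S = "{I. I \<subseteq> U \<and> card I = n}"
  let ?B = "{I. I \<subseteq> U \<and> card I = n \<and> n * p + n * \<eta> \<le> card (I \<inter> K)}"
  have finS: "finite ?S" by (rule finite_subset[of _ "Pow U"]) (use U in auto)
  have expI: "exp (h * card (I \<inter> K)) = (1 + (exp h - 1)) ^ card (I \<inter> K)" for I
    by (simp add: exp_of_nat2_mult)
  have "real (card ?B) * exp (h * (n * p + n * \<eta>)) = (\<Sum>I\<in>?B. exp (h * (n * p + n * \<eta>)))" by simp
  also have "\<dots> \<le> (\<Sum>I\<in>?B. exp (h * card (I \<inter> K)))"
    using h by (intro sum_mono) (auto intro: mult_left_mono)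
  also have "\<dots> \<le> (\<Sum>I\<in>?S. exp (h * card (I \<inter> K)))"
    using finS by (intro sum_mono2) auto
  also have "\<dots> \<le> (card U choose n) * (1 + (exp h - 1) * p) ^ n"
    unfolding expI p_def using h by (intro sum_subsets_power_card_le U K n) auto
  also have "\<dots> \<le> (card U choose n) * exp (h * p + h\<^sup>2 / 8) ^ n"
    using Hoeffding_bernoulli[OF h p] h p
    by (intro mult_left_mono power_mono) (auto simp: mult.commute)
  also have "exp (h * p + h\<^sup>2 / 8) ^ n = exp (n * (h * p + h\<^sup>2 / 8))"
    by (simp add: exp_of_nat_mult)
  finally have "real (card ?B) \<le> (card U choose n) * exp (n * (h * p + h\<^sup>2 / 8)) / exp (h * (n * p + n * \<eta>))"
    by (simp add: pos_le_divide_eq)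
  also have "\<dots> = (card U choose n) * exp (n * (h * p + h\<^sup>2 / 8) - h * (n * p + n * \<eta>))"
    by (simp add: exp_diff)
  also have "n * (h * p + h\<^sup>2 / 8) - h * (n * p + n * \<eta>) = - 2 * real n * \<eta>\<^sup>2"
    by (simp add: h_def power2_eq_square algebra_simps)
  finally show ?thesis by (simp add: p_def)
qed

text \<open>A deviation of \<open>K\<close> downwards is a deviation of \<open>U - K\<close>
  upwards, so the one-sided count is used twice.\<close>

lemma card_subsets_abs_deviation_ge:
  fixes \<eta> :: real
  assumes U: "finite U" "U \<noteq> {}" and K: "K \<subseteq> U" and n: "n \<le> card U" and eta: "\<eta> \<ge> 0"
  shows "card {I. I \<subseteq> U \<and> card I = n \<and> n * \<eta> \<le> \<bar>card (I \<inter> K) - n * (card K / card U)\<bar>}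
    \<le> 2 * (card U choose n) * exp (- 2 * real n * \<eta>\<^sup>2)"
proof -
  let ?B = "\<lambda>K. {I. I \<subseteq> U \<and> card I = n \<and> n * (card K / card U) + n * \<eta> \<le> card (I \<inter> K)}"
  have finB: "finite (?B K)" for K by (rule finite_subset[of _ "Pow U"]) (use U in auto)
  have N: "card U > 0" using U by (simp add: card_gt_0_iff)
  have finK: "finite K" using U K finite_subset by blast
  have "{I. I \<subseteq> U \<and> card I = n \<and> n * \<eta> \<le> \<bar>card (I \<inter> K) - n * (card K / card U)\<bar>} \<subseteq> ?B K \<union> ?B (U - K)"
  proof
    fix I assume "I \<in> {I. I \<subseteq> U \<and> card I = n \<and> n * \<eta> \<le> \<bar>card (I \<inter> K) - n * (card K / card U)\<bar>}"
    then have I: "I \<subseteq> U" "card I = n" "n * \<eta> \<le> \<bar>card (I \<inter> K) - n * (card K / card U)\<bar>" by auto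
    have "finite I" using I(1) U finite_subset by blast
    then have "card (I \<inter> K) + card (I \<inter> (U - K)) = n"
      using I by (subst card_Un_disjoint[symmetric]) (auto intro!: arg_cong[where f = card] simp: I(2)[symmetric])
    then have c: "real (card (I \<inter> (U - K))) = n - card (I \<inter> K)" by linarith
    have "card (U - K) = card U - card K" using K finK by (simp add: card_Diff_subset)
    moreover have "card K \<le> card U" using K U by (intro card_mono)
    ultimately have "real (card (U - K)) / card U = 1 - card K / card U"
      using N by (simp add: of_nat_diff diff_divide_distrib)
    then have "real n * (real (card (U - K)) / card U) = n * (1 - card K / card U)"
      by (simp only:)
    then have "real n * (real (card (U - K)) / card U) = n - n * (card K / card U)"
      by (simp only: right_diff_distrib mult_1_right)
    then show "I \<in> ?B K \<union> ?B (U - K)" using I c by (auto simp: abs_if split: if_splits)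
  qed
  then have "card {I. I \<subseteq> U \<and> card I = n \<and> n * \<eta> \<le> \<bar>card (I \<inter> K) - n * (card K / card U)\<bar>}
      \<le> card (?B K \<union> ?B (U - K))" using finB by (intro card_mono) auto
  also have "\<dots> \<le> card (?B K) + card (?B (U - K))" by (rule card_Un_le)
  finally have "real (card {I. I \<subseteq> U \<and> card I = n \<and> n * \<eta> \<le> \<bar>card (I \<inter> K) - n * (card K / card U)\<bar>})
      \<le> real (card (?B K)) + real (card (?B (U - K)))" by linarith
  also have "\<dots> \<le> (card U choose n) * exp (- 2 * real n * \<eta>\<^sup>2) + (card U choose n) * exp (- 2 * real n * \<eta>\<^sup>2)"
    using card_subsets_deviation_ge[OF U(1) K n eta]
      card_subsets_deviation_ge[OF U(1) Diff_subset[of U K] n eta] by (rule add_mono)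
  finally show ?thesis by simp
qed

section \<open>Counting the sample points in a set\<close>

text \<open>The unnormalised empirical measure. The index set is a parameter because the same count
  serves the sample, the ghost sample, their pool, and the random set of indices whose points lie in
  the tail.\<close>

definition hits :: "'i set \<Rightarrow> 'a set \<Rightarrow> ('i \<Rightarrow> 'a) \<Rightarrow> nat" where
  "hits I A x = card {i\<in>I. x i \<in> A}"

lemma hits_le_card: "finite I \<Longrightarrow> hits I A x \<le> card I"
  unfolding hits_def by (intro card_mono) auto

lemma hits_mono: "finite I \<Longrightarrow> A \<subseteq> B \<Longrightarrow> hits I A x \<le> hits I B x"
  unfolding hits_def by (intro card_mono) auto

lemma hits_Un_disjoint:
  "finite I \<Longrightarrow> finite J \<Longrightarrow> I \<inter> J = {} \<Longrightarrow> hits (I \<union> J) A x = hits I A x + hits J A x"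
  unfolding hits_def by (subst card_Un_disjoint[symmetric]) (auto intro!: arg_cong[where f = card])

lemma hits_cong: "(\<And>i. i \<in> I \<Longrightarrow> x i = y i) \<Longrightarrow> hits I A x = hits I A y"
  unfolding hits_def by (auto intro!: arg_cong[where f = card])

lemma hits_reindex:
  assumes "bij_betw t I I'"
  shows "hits I A (\<lambda>i. x (t i)) = hits I' A x"
proof -
  have "bij_betw t {i\<in>I. x (t i) \<in> A} {i\<in>I'. x i \<in> A}"
    using assms by (rule bij_betw_Collect) auto
  then show ?thesis unfolding hits_def by (rule bij_betw_same_card)
qed

lemma hits_eq_sum: "finite I \<Longrightarrow> real (hits I A x) = (\<Sum>i\<in>I. indicator A (x i))"
  by (simp add: hits_def indicator_def sum.If_cases Int_def)

lemma borel_measurable_hits: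
  assumes "finite I" "\<And>i. i \<in> I \<Longrightarrow> X i \<in> measurable M N" "A \<in> sets N"
  shows "(\<lambda>\<omega>. real (hits I A (\<lambda>i. X i \<omega>))) \<in> borel_measurable M"
  unfolding hits_eq_sum[OF assms(1)]
proof (rule borel_measurable_sum)
  fix i assume "i \<in> I"
  then show "(\<lambda>\<omega>. indicator A (X i \<omega>) :: real) \<in> borel_measurable M"
    using measurable_compose[OF assms(2) borel_measurable_indicator[OF assms(3)]] by blast
qed

lemma borel_measurable_hits_PiM:
  assumes "finite I" "I \<subseteq> K" "A \<in> sets N"
  shows "(\<lambda>\<omega>. real (hits I A \<omega>)) \<in> borel_measurable (PiM K (\<lambda>_. N))"
proof -
  have "(\<lambda>\<omega>. \<omega> i) \<in> measurable (PiM K (\<lambda>_. N)) N" if "i \<in> I" for i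
    using that assms(2) by (auto intro: measurable_component_singleton)
  then show ?thesis by (rule borel_measurable_hits[OF assms(1) _ assms(3)])
qed

lemma (in prob_space) hits_Hoeffding:
  fixes p s :: real
  assumes ind: "indep_vars (\<lambda>_. N) X I" and I: "finite I" "I \<noteq> {}" and A: "A \<in> sets N"
    and p: "\<And>i. i \<in> I \<Longrightarrow> prob (X i -` A \<inter> space M) = p" and s: "s \<ge> 0"
  shows "prob {\<omega>\<in>space M. s \<le> \<bar>hits I A (\<lambda>i. X i \<omega>) - card I * p\<bar>} \<le> 2 * exp (- 2 * s\<^sup>2 / card I)"
proof -
  have rv: "X i \<in> measurable M N" if "i \<in> I" for i using ind that by (auto simp: indep_vars_def)
  have E: "expectation (\<lambda>\<omega>. indicator A (X i \<omega>) :: real) = p" if i: "i \<in> I" for i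
  proof -
    have "expectation (\<lambda>\<omega>. indicator A (X i \<omega>) :: real) = expectation (indicator (X i -` A \<inter> space M))"
      by (intro Bochner_Integration.integral_cong) (auto simp: indicator_def)
    then show ?thesis using p[OF i] measurable_sets[OF rv[OF i] A] by simp
  qed
  interpret Hoeffding_ineq M I "\<lambda>i \<omega>. indicator A (X i \<omega>)" "\<lambda>_. 0" "\<lambda>_. 1" "card I * p"
  proof unfold_locales
    show "indep_vars (\<lambda>_. borel) (\<lambda>i \<omega>. indicator A (X i \<omega>) :: real) I"
      using A by (intro indep_vars_compose2[OF ind]) simp
    show "real (card I) * p \<equiv> \<Sum>i\<in>I. expectation (\<lambda>\<omega>. indicator A (X i \<omega>))" using E by simp
  qed (use I in \<open>auto simp: indicator_def\<close>)
  show ?thesis using Hoeffding_ineq_abs_ge[OF s] I by (simp add: hits_eq_sum card_gt_0_iff)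
qed

text \<open>By independence the moment generating function of the count is a power. The sign of
  \<open>h\<close> is free: negative \<open>h\<close> and \<open>c\<close> yield the lower
  tail.\<close>

lemma (in prob_space) hits_Chernoff:
  fixes p c h :: real
  assumes ind: "indep_vars (\<lambda>_. N) X I" and I: "finite I" and A: "A \<in> sets N"
    and p: "\<And>i. i \<in> I \<Longrightarrow> prob (X i -` A \<inter> space M) = p"
  shows "prob {\<omega>\<in>space M. c \<le> h * hits I A (\<lambda>i. X i \<omega>)} \<le> exp (- c) * (1 + p * (exp h - 1)) ^ card I"
proof -
  note A [measurable]
  have rv: "X i \<in> measurable M N" if "i \<in> I" for i using ind that by (auto simp: indep_vars_def)
  let ?Y = "\<lambda>i \<omega>. exp (h * indicator A (X i \<omega>)) :: real"
  have E: "expectation (?Y i) = 1 + p * (exp h - 1)" and int: "integrable M (?Y i)" if i: "i \<in> I" for i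
  proof -
    have S: "X i -` A \<inter> space M \<in> events" using measurable_sets[OF rv[OF i] A] .
    have eq: "?Y i \<omega> = 1 + (exp h - 1) * indicator (X i -` A \<inter> space M) \<omega>" if "\<omega> \<in> space M" for \<omega>
      using that by (auto simp: indicator_def)
    have int': "integrable M (\<lambda>\<omega>. 1 + (exp h - 1) * indicator (X i -` A \<inter> space M) \<omega>)"
      using S by (intro Bochner_Integration.integrable_add integrable_mult_right) (auto simp: emeasure_eq_measure)
    then show "integrable M (?Y i)" by (subst Bochner_Integration.integrable_cong[OF refl eq])
    have "expectation (?Y i) = expectation (\<lambda>\<omega>. 1 + (exp h - 1) * indicator (X i -` A \<inter> space M) \<omega>)"
      using eq by (rule Bochner_Integration.integral_cong[OF refl])
    also have "\<dots> = 1 + (exp h - 1) * prob (X i -` A \<inter> space M)"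
      using S by (subst Bochner_Integration.integral_add) (auto simp: emeasure_eq_measure prob_space)
    finally show "expectation (?Y i) = 1 + p * (exp h - 1)" using p[OF i] by (simp add: mult.commute)
  qed
  have ind': "indep_vars (\<lambda>_. borel) ?Y I"
    by (intro indep_vars_compose2[OF ind]) measurable
  \<comment> \<open>Chernoff's inequality is applied with parameter 1 to the variable
    \<open>h * hits\<close>, which is what keeps the sign of \<open>h\<close> free.\<close>
  have eq: "exp (1 * (h * hits I A (\<lambda>i. X i \<omega>))) = (\<Prod>i\<in>I. ?Y i \<omega>)" for \<omega>
    by (simp only: hits_eq_sum[OF I] sum_distrib_left exp_sum[OF I] mult_1_left)
  have int_prod: "integrable M (\<lambda>\<omega>. \<Prod>i\<in>I. ?Y i \<omega>)"
    by (rule indep_vars_integrable[OF I ind' int])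
  have "prob {\<omega>\<in>space M. c \<le> h * hits I A (\<lambda>i. X i \<omega>)}
      \<le> exp (- 1 * c) * (\<integral>\<omega>\<in>space M. exp (1 * (h * hits I A (\<lambda>i. X i \<omega>))) \<partial>M)"
  proof (rule Chernoff_ineq_ge)
    show "set_integrable M (space M) (\<lambda>\<omega>. exp (1 * (h * hits I A (\<lambda>i. X i \<omega>))))"
      unfolding eq set_integrable_def
      by (subst Bochner_Integration.integrable_cong[OF refl, where g = "\<lambda>\<omega>. \<Prod>i\<in>I. ?Y i \<omega>"])
        (use int_prod in auto)
  qed auto
  also have "(\<integral>\<omega>\<in>space M. exp (1 * (h * hits I A (\<lambda>i. X i \<omega>))) \<partial>M) = expectation (\<lambda>\<omega>. \<Prod>i\<in>I. ?Y i \<omega>)"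
    unfolding eq using int_prod by (rule set_integral_space)
  also have "\<dots> = (\<Prod>i\<in>I. expectation (?Y i))" by (rule indep_vars_lebesgue_integral[OF I ind' int])
  also have "\<dots> = (1 + p * (exp h - 1)) ^ card I" using E by simp
  finally show ?thesis by simp
qed

text \<open>By independence, a deviation that occurs on the indices \<open>I\<close> is confirmed by an event on the
  fresh indices \<open>J\<close> with probability at least \<open>1/2\<close>; taking the first deviating \<open>j\<close> makes
  the events disjoint.\<close>

lemma (in prob_space) ghost_sample:
  fixes E G :: "nat \<Rightarrow> ('i \<Rightarrow> 'b) set"
  assumes ind: "indep_vars (\<lambda>_. N) X (I \<union> J)" and IJ: "I \<inter> J = {}"
    and E: "\<And>j. E j \<in> sets (PiM I (\<lambda>_. N))" and G: "\<And>j. G j \<in> sets (PiM J (\<lambda>_. N))"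
    and half: "\<And>j. 1 / 2 \<le> prob {\<omega>\<in>space M. restrict (\<lambda>i. X i \<omega>) J \<in> G j}"
  shows "prob {\<omega>\<in>space M. \<exists>j. restrict (\<lambda>i. X i \<omega>) I \<in> E j}
    \<le> 2 * prob {\<omega>\<in>space M. \<exists>j. restrict (\<lambda>i. X i \<omega>) I \<in> E j \<and> restrict (\<lambda>i. X i \<omega>) J \<in> G j}"
proof -
  let ?XI = "\<lambda>\<omega>. restrict (\<lambda>i. X i \<omega>) I" and ?XJ = "\<lambda>\<omega>. restrict (\<lambda>i. X i \<omega>) J"
  let ?D = "disjointed E"
  have D: "?D j \<in> sets (PiM I (\<lambda>_. N))" for j
    using sets.range_disjointed_sets[of E "PiM I (\<lambda>_. N)"] E by auto
  have iv: "indep_var (PiM I (\<lambda>_. N)) ?XI (PiM J (\<lambda>_. N)) ?XJ"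
    using ind IJ by (intro indep_var_restrict) auto
  have XI [measurable]: "?XI \<in> measurable M (PiM I (\<lambda>_. N))"
    and XJ [measurable]: "?XJ \<in> measurable M (PiM J (\<lambda>_. N))"
    using indep_var_rv1[OF iv] indep_var_rv2[OF iv] by auto
  define B where "B j = ?XI -` ?D j \<inter> space M" for j
  define C where "C j = {\<omega>\<in>space M. ?XI \<omega> \<in> ?D j \<and> ?XJ \<omega> \<in> G j}" for j
  have B: "B j \<in> events" for j unfolding B_def using XI D by (rule measurable_sets)
  have C': "C j = B j \<inter> (?XJ -` G j \<inter> space M)" for j by (auto simp: B_def C_def)
  have C: "C j \<in> events" for j unfolding C' using B measurable_sets[OF XJ G] by auto
  have disj: "disjoint_family B" "disjoint_family C"
    using disjoint_family_disjointed[of E] unfolding B_def C_def disjoint_family_on_def by blast+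
  have "prob (B j) \<le> 2 * prob (C j)" for j
  proof -
    have "prob (C j) = prob ((\<lambda>\<omega>. (?XI \<omega>, ?XJ \<omega>)) -` (?D j \<times> G j) \<inter> space M)"
      by (rule arg_cong[where f = prob]) (auto simp: C_def)
    also have "\<dots> = prob (B j) * prob (?XJ -` G j \<inter> space M)"
      unfolding B_def by (rule indep_varD[OF iv D G])
    also have "?XJ -` G j \<inter> space M = {\<omega>\<in>space M. ?XJ \<omega> \<in> G j}" by auto
    finally have "prob (C j) = prob (B j) * prob {\<omega>\<in>space M. ?XJ \<omega> \<in> G j}" .
    moreover have "prob (B j) * (1 / 2) \<le> prob (B j) * prob {\<omega>\<in>space M. ?XJ \<omega> \<in> G j}"
      by (rule mult_left_mono[OF half]) simp
    ultimately show ?thesis by simp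
  qed
  moreover have "(\<lambda>j. prob (B j)) sums prob (\<Union>j. B j)"
    using B disj by (intro finite_measure_UNION) auto
  moreover have "(\<lambda>j. 2 * prob (C j)) sums (2 * prob (\<Union>j. C j))"
    using C disj by (intro sums_mult finite_measure_UNION) auto
  ultimately have "prob (\<Union>j. B j) \<le> 2 * prob (\<Union>j. C j)" by (rule sums_le)
  moreover have "(\<Union>j. B j) = {\<omega>\<in>space M. \<exists>j. ?XI \<omega> \<in> E j}"
    using UN_disjointed_eq[of E] unfolding B_def by (auto simp flip: vimage_UN)
  moreover have "prob (\<Union>j. C j) \<le> prob {\<omega>\<in>space M. \<exists>j. ?XI \<omega> \<in> E j \<and> ?XJ \<omega> \<in> G j}"
  proof (rule finite_measure_mono)
    show "(\<Union>j. C j) \<subseteq> {\<omega>\<in>space M. \<exists>j. ?XI \<omega> \<in> E j \<and> ?XJ \<omega> \<in> G j}"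
      using disjointed_subset[of E] unfolding C_def by blast
    have "{\<omega>\<in>space M. \<exists>j. ?XI \<omega> \<in> E j \<and> ?XJ \<omega> \<in> G j}
        = (\<Union>j. (?XI -` E j \<inter> space M) \<inter> (?XJ -` G j \<inter> space M))" by auto
    then show "{\<omega>\<in>space M. \<exists>j. ?XI \<omega> \<in> E j \<and> ?XJ \<omega> \<in> G j} \<in> events"
      using measurable_sets[OF XI E] measurable_sets[OF XJ G] by (auto intro!: sets.countable_UN)
  qed
  ultimately show ?thesis by simp
qed

lemma indep_vars_PiM_coordinates:
  assumes "prob_space Q" "U \<noteq> {}"
  shows "prob_space.indep_vars (PiM U (\<lambda>_. Q)) (\<lambda>_. Q) (\<lambda>i \<omega>. \<omega> i) U"
proof -
  interpret P: prob_space "PiM U (\<lambda>_. Q)" by (rule prob_space_PiM) (rule assms(1))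
  have "distr (PiM U (\<lambda>_. Q)) (PiM U (\<lambda>_. Q)) (\<lambda>x. \<lambda>i\<in>U. x i) = distr (PiM U (\<lambda>_. Q)) (PiM U (\<lambda>_. Q)) (\<lambda>x. x)"
    by (intro distr_cong refl) (auto simp: space_PiM)
  also have "\<dots> = PiM U (\<lambda>_. Q)" by (rule distr_id)
  also have "\<dots> = PiM U (\<lambda>i. distr (PiM U (\<lambda>_. Q)) Q (\<lambda>\<omega>. \<omega> i))"
    using distr_PiM_component[of U "\<lambda>_. Q"] assms(1) by (intro PiM_cong) auto
  finally show ?thesis
    using assms(2) by (subst P.indep_vars_iff_distr_eq_PiM') auto
qed

section \<open>Devroye's inequality\<close>

text \<open>Here \<open>a\<close> is \<open>1 / n\<close> and \<open>(1 - a) * (e - a)\<close> is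
  the deviation left after passing to the pooled frequency. Multiplied by \<open>2 * n\<close>, the
  loss \<open>2 * a * e + 2 * a * e\<^sup>2\<close> is the term \<open>4 * e + 4 * e\<^sup>2\<close>
  of Devroye's exponent.\<close>

lemma ghost_exponent_le:
  fixes e a :: real
  assumes "e \<ge> 0" "0 \<le> a" "a \<le> 1 / 4"
  shows "e\<^sup>2 - 2 * a * e - 2 * a * e\<^sup>2 \<le> ((1 - a) * (e - a))\<^sup>2"
proof -
  have "((1 - a) * (e - a))\<^sup>2 - (e\<^sup>2 - 2 * a * e - 2 * a * e\<^sup>2)
      = a\<^sup>2 * (1 - 2 * a + e * (4 - 2 * a) + e\<^sup>2 + a\<^sup>2)"
    by (simp add: power2_eq_square algebra_simps)
  also have "\<dots> \<ge> 0" using assms by (intro mult_nonneg_nonneg add_nonneg_nonneg) auto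
  finally show ?thesis by simp
qed

text \<open>The sample is the fraction \<open>a\<close> of the pool, so its deviation from the
  pooled frequency is \<open>1 - a\<close> times its true deviation minus \<open>a\<close> times
  that of the ghost sample, which is assumed small.\<close>

lemma ghost_deviation:
  fixes h h' n q e a :: real
  assumes n: "n \<ge> 1" and a: "a = 1 / n" and h: "n * e < \<bar>h - n * q\<bar>"
    and h': "\<bar>h' - (n\<^sup>2 - n) * q\<bar> < (n\<^sup>2 - n) / n"
  shows "n * ((1 - a) * (e - a)) \<le> \<bar>h - n * ((h + h') / n\<^sup>2)\<bar>"
proof -
  have "h - n * ((h + h') / n\<^sup>2) = (1 - a) * (h - n * q) - a * (h' - (n\<^sup>2 - n) * q)"
    using n by (simp add: a field_simps power2_eq_square)
  then have "\<bar>h - n * ((h + h') / n\<^sup>2)\<bar> \<ge> \<bar>(1 - a) * (h - n * q)\<bar> - \<bar>a * (h' - (n\<^sup>2 - n) * q)\<bar>"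
    by linarith
  moreover have "\<bar>(1 - a) * (h - n * q)\<bar> = (1 - a) * \<bar>h - n * q\<bar>" using n by (simp add: abs_mult a)
  moreover have "(1 - a) * (n * e) \<le> (1 - a) * \<bar>h - n * q\<bar>"
    using n h by (intro mult_left_mono) (auto simp: a)
  moreover have "\<bar>a * (h' - (n\<^sup>2 - n) * q)\<bar> = a * \<bar>h' - (n\<^sup>2 - n) * q\<bar>" using n by (simp add: abs_mult a)
  moreover have "a * \<bar>h' - (n\<^sup>2 - n) * q\<bar> \<le> a * ((n\<^sup>2 - n) / n)"
    using n h' by (intro mult_left_mono) (auto simp: a)
  moreover have "(1 - a) * (n * e) - a * ((n\<^sup>2 - n) / n) = n * ((1 - a) * (e - a))"
    using n by (simp add: a field_simps power2_eq_square)
  ultimately show ?thesis by linarith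
qed

text \<open>Hoeffding's inequality bounds the failure of the ghost sample by
  \<open>2 * exp (- 2 * (1 - 1 / n))\<close>; for \<open>n \<ge> 4\<close> this is at most the
  number estimated here, and the ghost sample argument asks for 1/2.\<close>

lemma two_exp_minus_three_halves_le: "2 * exp (- (3 / 2) :: real) \<le> 1 / 2"
proof -
  have "(1 + 1 / 2 + (1 / 2)\<^sup>2 / 2 :: real) \<le> exp (1 / 2)" by (rule exp_lower_Taylor_quadratic) simp
  then have "(13 / 8 :: real) ^ 3 \<le> exp (1 / 2) ^ 3" by (intro power_mono) (auto simp: power2_eq_square)
  also have "\<dots> = exp (3 / 2 :: real)" by (simp flip: exp_of_nat_mult)
  finally have "4 \<le> exp (3 / 2 :: real)" by (simp add: power3_eq_cube)
  then show ?thesis by (simp add: exp_minus field_simps)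
qed

text \<open>Compare the sample with a ghost sample of size \<open>n\<^sup>2 - n\<close>. Given the pooled sample
  of size \<open>n\<^sup>2\<close>, the original one is a uniform subset of size \<open>n\<close>, and only
  finitely many traces matter.\<close>

theorem Devroye_inequality:
  fixes A :: "nat \<Rightarrow> 'a set" and I :: "'i set" and e :: real
  assumes Q: "prob_space Q" and A: "\<And>j. A j \<in> sets Q"
    and I: "finite I" "card I = n" and n: "n \<ge> 4" and e: "1 < n * e"
    and s: "\<And>x :: nat \<Rightarrow> 'a. card (range (\<lambda>j. {i\<in>{..<n\<^sup>2}. x i \<in> A j})) \<le> s"
  shows "measure (PiM I (\<lambda>_. Q))
      {\<omega>\<in>space (PiM I (\<lambda>_. Q)). \<exists>j. n * e < \<bar>hits I (A j) \<omega> - n * measure Q (A j)\<bar>}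
    \<le> 4 * real s * exp (4 * e + 4 * e\<^sup>2 - 2 * real n * e\<^sup>2)"
proof -
  define U where "U = {..<n\<^sup>2}"
  define R where "R = PiM U (\<lambda>_. Q)"
  define a where "a = 1 / real n"
  define \<eta> where "\<eta> = (1 - a) * (e - a)"
  define S where "S = {I'. I' \<subseteq> U \<and> card I' = n}"
  define Bad where "Bad I' \<omega> \<longleftrightarrow> (\<exists>j. n * e < \<bar>hits I' (A j) \<omega> - n * measure Q (A j)\<bar>)" for I' :: "nat set" and \<omega>
  define Dev where "Dev I' \<omega> \<longleftrightarrow> (\<exists>j. n * \<eta> \<le> \<bar>hits I' (A j) \<omega> - n * (hits U (A j) \<omega> / n\<^sup>2)\<bar>)" for I' and \<omega> :: "nat \<Rightarrow> 'a"
  let ?b = "measure (PiM I (\<lambda>_. Q))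
      {\<omega>\<in>space (PiM I (\<lambda>_. Q)). \<exists>j. n * e < \<bar>hits I (A j) \<omega> - n * measure Q (A j)\<bar>}"
  interpret Q: prob_space Q by (rule Q)
  interpret R: prob_space R unfolding R_def by (rule prob_space_PiM) (rule Q)
  have e0: "e > 0" using e n by (smt (verit) mult_nonneg_nonpos of_nat_0_le_iff)
  have a: "0 \<le> a" "a \<le> 1 / 4" "a \<le> e" using n e by (auto simp: a_def field_simps)
  have finU: "finite U" and cardU: "card U = n\<^sup>2" by (auto simp: U_def)
  have nn: "n \<le> n\<^sup>2" using n by (simp add: power2_eq_square)
  have finS: "finite S" unfolding S_def by (rule finite_subset[of _ "Pow U"]) (use finU in auto)
  have meas [measurable]: "(\<lambda>\<omega>. real (hits I' (A j) \<omega>)) \<in> borel_measurable R" if "I' \<subseteq> U" for I' j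
    unfolding R_def using that finU A finite_subset by (intro borel_measurable_hits_PiM) auto
  have Dev_meas: "{\<omega>\<in>space R. Dev I' \<omega>} \<in> sets R" if "I' \<subseteq> U" for I'
    unfolding Dev_def using that by measurable
  have int_Dev: "integrable R (indicator {\<omega>\<in>space R. Dev I' \<omega>} :: _ \<Rightarrow> real)" if "I' \<subseteq> U" for I'
    using Dev_meas[OF that] by (rule integrable_real_indicator) (simp add: R.emeasure_eq_measure)
  \<comment> \<open>The points are exchangeable, so the bad event has the same probability
    \<open>?b\<close> on every \<open>n\<close>-subset of the pool. Averaging these bounds over all
    subsets, with sum and expectation exchanged, reduces the problem to counting deviating subsets
    of a fixed pool.\<close>
  have ghost: "?b \<le> 2 * measure R {\<omega>\<in>space R. Dev I' \<omega>}" if I': "I' \<in> S" for I'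
  proof -
    define J where "J = U - I'"
    have sub: "I' \<subseteq> U" "J \<subseteq> U" "I' \<union> J = U" "I' \<inter> J = {}" and cardI': "card I' = n"
      using I' by (auto simp: S_def J_def)
    have fin: "finite I'" "finite J" using sub finU finite_subset by auto
    have cardJ: "real (card J) = real n ^ 2 - n"
      using sub fin cardI' cardU nn by (simp add: J_def card_Diff_subset of_nat_diff)
    have Jpos: "real n ^ 2 - n > 0" using n by (simp add: power2_eq_square)
    have Jne: "J \<noteq> {}" using cardJ Jpos by auto
    obtain t where t: "bij_betw t I I'"
      using finite_same_card_bij[OF I(1) fin(1)] I(2) cardI' by auto
    have dist: "distr R (PiM I (\<lambda>_. Q)) (\<lambda>\<omega>. \<lambda>i\<in>I. \<omega> (t i)) = PiM I (\<lambda>_. Q)"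
      unfolding R_def using t sub Q by (intro distr_PiM_reindex) (auto simp: bij_betw_def)
    have tm: "(\<lambda>\<omega>. \<lambda>i\<in>I. \<omega> (t i)) \<in> measurable R (PiM I (\<lambda>_. Q))"
      unfolding R_def using t sub
      by (intro measurable_restrict measurable_component_singleton) (auto simp: bij_betw_def)
    have bm: "{\<omega>\<in>space (PiM I (\<lambda>_. Q)). \<exists>j. n * e < \<bar>hits I (A j) \<omega> - n * measure Q (A j)\<bar>}
        \<in> sets (PiM I (\<lambda>_. Q))"
    proof -
      have [measurable]: "(\<lambda>\<omega>. real (hits I (A j) \<omega>)) \<in> borel_measurable (PiM I (\<lambda>_. Q))" for j
        using I A by (intro borel_measurable_hits_PiM) auto
      show ?thesis by measurable
    qed
    have "?b = measure R ((\<lambda>\<omega>. \<lambda>i\<in>I. \<omega> (t i)) -`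
        {\<omega>\<in>space (PiM I (\<lambda>_. Q)). \<exists>j. n * e < \<bar>hits I (A j) \<omega> - n * measure Q (A j)\<bar>} \<inter> space R)"
      using measure_distr[OF tm bm] unfolding dist .
    also have "\<dots> = measure R {\<omega>\<in>space R. Bad I' \<omega>}"
    proof (rule arg_cong[where f = "measure R"])
      have "hits I (A j) (\<lambda>i\<in>I. \<omega> (t i)) = hits I' (A j) \<omega>" for j \<omega>
        using hits_reindex[OF t, of "A j" \<omega>] by (simp cong: hits_cong)
      then show "(\<lambda>\<omega>. \<lambda>i\<in>I. \<omega> (t i)) -`
        {\<omega>\<in>space (PiM I (\<lambda>_. Q)). \<exists>j. n * e < \<bar>hits I (A j) \<omega> - n * measure Q (A j)\<bar>} \<inter> space R
        = {\<omega>\<in>space R. Bad I' \<omega>}"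
        using measurable_space[OF tm] by (auto simp: Bad_def)
    qed
    finally have b: "?b = measure R {\<omega>\<in>space R. Bad I' \<omega>}" .
    have ind: "R.indep_vars (\<lambda>_. Q) (\<lambda>i \<omega>. \<omega> i) U"
      unfolding R_def by (rule indep_vars_PiM_coordinates) (use Q sub Jne in auto)
    define E where "E j = {\<omega>\<in>space (PiM I' (\<lambda>_. Q)). n * e < \<bar>hits I' (A j) \<omega> - n * measure Q (A j)\<bar>}" for j
    define G where "G j = {\<omega>\<in>space (PiM J (\<lambda>_. Q)).
        \<bar>hits J (A j) \<omega> - (real n ^ 2 - n) * measure Q (A j)\<bar> < (real n ^ 2 - n) / n}" for j
    have E: "E j \<in> sets (PiM I' (\<lambda>_. Q))" for j
    proof -
      have [measurable]: "(\<lambda>\<omega>. real (hits I' (A j) \<omega>)) \<in> borel_measurable (PiM I' (\<lambda>_. Q))"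
        using fin A by (intro borel_measurable_hits_PiM) auto
      show ?thesis unfolding E_def by measurable
    qed
    have G: "G j \<in> sets (PiM J (\<lambda>_. Q))" for j
    proof -
      have [measurable]: "(\<lambda>\<omega>. real (hits J (A j) \<omega>)) \<in> borel_measurable (PiM J (\<lambda>_. Q))"
        using fin A by (intro borel_measurable_hits_PiM) auto
      show ?thesis unfolding G_def by measurable
    qed
    have spI: "restrict \<omega> I' \<in> space (PiM I' (\<lambda>_. Q))" and spJ: "restrict \<omega> J \<in> space (PiM J (\<lambda>_. Q))"
      if "\<omega> \<in> space R" for \<omega>
      using that sub by (auto simp: R_def space_PiM)
    have inE: "restrict \<omega> I' \<in> E j \<longleftrightarrow> n * e < \<bar>hits I' (A j) \<omega> - n * measure Q (A j)\<bar>"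
      and inG: "restrict \<omega> J \<in> G j \<longleftrightarrow>
        \<bar>hits J (A j) \<omega> - (real n ^ 2 - n) * measure Q (A j)\<bar> < (real n ^ 2 - n) / n"
      if "\<omega> \<in> space R" for \<omega> j
      using spI[OF that] spJ[OF that] by (simp_all add: E_def G_def cong: hits_cong)
    have half: "1 / 2 \<le> R.prob {\<omega>\<in>space R. restrict \<omega> J \<in> G j}" for j
    proof -
      let ?F = "{\<omega>\<in>space R. (real n ^ 2 - n) / n \<le> \<bar>hits J (A j) \<omega> - card J * measure Q (A j)\<bar>}"
      have "R.prob ?F \<le> 2 * exp (- 2 * ((real n ^ 2 - n) / n)\<^sup>2 / card J)"
      proof (rule R.hits_Hoeffding[where N = Q])
        show "R.indep_vars (\<lambda>_. Q) (\<lambda>i \<omega>. \<omega> i) J" by (rule R.indep_vars_subset[OF ind sub(2)])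
        show "R.prob ((\<lambda>\<omega>. \<omega> i) -` A j \<inter> space R) = Q.prob (A j)" if "i \<in> J" for i
        proof -
          have i: "i \<in> U" using that sub by auto
          have "distr R Q (\<lambda>\<omega>. \<omega> i) = Q"
            unfolding R_def using Q i by (intro distr_PiM_component) auto
          have "(\<lambda>\<omega>. \<omega> i) \<in> measurable R Q" unfolding R_def using i by simp
          from measure_distr[OF this A, of j] show ?thesis using \<open>distr R Q (\<lambda>\<omega>. \<omega> i) = Q\<close> by simp
        qed
        show "0 \<le> (real n ^ 2 - n) / n" using Jpos by simp
      qed (use fin Jne A in auto)
      also have "- 2 * ((real n ^ 2 - n) / n)\<^sup>2 / card J = - 2 * (1 - a)"
        unfolding cardJ using Jpos n by (simp add: a_def field_simps power2_eq_square)
      also have "2 * exp (- 2 * (1 - a)) \<le> 2 * exp (- (3 / 2))" using a by simp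
      also have "\<dots> \<le> 1 / 2" by (rule two_exp_minus_three_halves_le)
      finally have F: "R.prob ?F \<le> 1 / 2" .
      have eq: "{\<omega>\<in>space R. restrict \<omega> J \<in> G j} = space R - ?F"
        using inG cardJ by (auto simp: not_le)
      have ev: "?F \<in> R.events" using sub(2) by measurable
      show ?thesis unfolding eq R.prob_compl[OF ev] using F by linarith
    qed
    have "{\<omega>\<in>space R. Bad I' \<omega>} = {\<omega>\<in>space R. \<exists>j. restrict \<omega> I' \<in> E j}"
      using inE by (auto simp: Bad_def)
    moreover have "R.prob {\<omega>\<in>space R. \<exists>j. restrict \<omega> I' \<in> E j}
        \<le> 2 * R.prob {\<omega>\<in>space R. \<exists>j. restrict \<omega> I' \<in> E j \<and> restrict \<omega> J \<in> G j}"
      by (rule R.ghost_sample[where X = "\<lambda>i \<omega>. \<omega> i" and N = Q]) (use ind sub E G half in auto)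
    moreover have "R.prob {\<omega>\<in>space R. \<exists>j. restrict \<omega> I' \<in> E j \<and> restrict \<omega> J \<in> G j}
        \<le> R.prob {\<omega>\<in>space R. Dev I' \<omega>}"
    proof (intro R.finite_measure_mono Dev_meas sub subsetI)
      fix \<omega> assume "\<omega> \<in> {\<omega>\<in>space R. \<exists>j. restrict \<omega> I' \<in> E j \<and> restrict \<omega> J \<in> G j}"
      then obtain j where w: "\<omega> \<in> space R" "restrict \<omega> I' \<in> E j" "restrict \<omega> J \<in> G j" by blast
      have "hits U (A j) \<omega> = hits I' (A j) \<omega> + hits J (A j) \<omega>"
        using hits_Un_disjoint[OF fin sub(4)] sub(3) by simp
      moreover have "real n * ((1 - a) * (e - a))
          \<le> \<bar>hits I' (A j) \<omega> - n * ((real (hits I' (A j) \<omega>) + hits J (A j) \<omega>) / (real n)\<^sup>2)\<bar>"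
        by (rule ghost_deviation[OF _ a_def]) (use n w inE inG in auto)
      ultimately have "n * \<eta> \<le> \<bar>hits I' (A j) \<omega> - n * (hits U (A j) \<omega> / n\<^sup>2)\<bar>"
        by (simp add: \<eta>_def)
      then show "\<omega> \<in> {\<omega>\<in>space R. Dev I' \<omega>}" using w(1) unfolding Dev_def by blast
    qed
    ultimately show ?thesis using b by simp
  qed
  \<comment> \<open>For a fixed pool a set \<open>A j\<close> enters only through its trace
    \<open>K\<close>. Hence the deviating subsets are covered by at most \<open>s\<close> families,
    each bounded by sampling without replacement.\<close>
  have count: "real (card {I'\<in>S. Dev I' \<omega>}) \<le> s * (2 * (n\<^sup>2 choose n) * exp (- 2 * real n * \<eta>\<^sup>2))" for \<omega>
  proof -
    define T where "T = range (\<lambda>j. {i\<in>U. \<omega> i \<in> A j})"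
    define D where "D K = {I'. I' \<subseteq> U \<and> card I' = n \<and> n * \<eta> \<le> \<bar>card (I' \<inter> K) - n * (card K / card U)\<bar>}" for K
    have T: "finite T" "\<And>K. K \<in> T \<Longrightarrow> K \<subseteq> U"
      unfolding T_def by (rule finite_subset[of _ "Pow U"]) (use finU in auto)
    have finD: "finite (D K)" for K unfolding D_def by (rule finite_subset[of _ "Pow U"]) (use finU in auto)
    have "{I'\<in>S. Dev I' \<omega>} \<subseteq> (\<Union>K\<in>T. D K)"
    proof clarify
      fix I' assume I': "I' \<in> S" "Dev I' \<omega>"
      then obtain j where j: "n * \<eta> \<le> \<bar>hits I' (A j) \<omega> - n * (hits U (A j) \<omega> / n\<^sup>2)\<bar>"
        by (auto simp: Dev_def)
      define K where "K = {i\<in>U. \<omega> i \<in> A j}"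
      have "I' \<inter> K = {i\<in>I'. \<omega> i \<in> A j}" using I' by (auto simp: S_def K_def)
      then have "I' \<in> D K" using I' j by (simp add: D_def S_def hits_def K_def cardU)
      then show "I' \<in> (\<Union>K\<in>T. D K)" by (auto simp: T_def K_def)
    qed
    then have "card {I'\<in>S. Dev I' \<omega>} \<le> card (\<Union>K\<in>T. D K)"
      using T finD by (intro card_mono) auto
    also have "\<dots> \<le> (\<Sum>K\<in>T. card (D K))" by (rule card_UN_le[OF T(1)])
    finally have "real (card {I'\<in>S. Dev I' \<omega>}) \<le> (\<Sum>K\<in>T. real (card (D K)))"
      by (metis of_nat_le_iff of_nat_sum)
    also have "\<dots> \<le> (\<Sum>K\<in>T. 2 * (n\<^sup>2 choose n) * exp (- 2 * real n * \<eta>\<^sup>2))"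
    proof (rule sum_mono)
      fix K assume "K \<in> T"
      then have "K \<subseteq> U" using T by auto
      moreover have "\<eta> \<ge> 0" using a by (auto simp: \<eta>_def)
      moreover have "U \<noteq> {}" using cardU n by auto
      ultimately show "real (card (D K)) \<le> 2 * (n\<^sup>2 choose n) * exp (- 2 * real n * \<eta>\<^sup>2)"
        unfolding D_def using card_subsets_abs_deviation_ge[of U K n \<eta>] finU cardU nn by simp
    qed
    also have "\<dots> = card T * (2 * (n\<^sup>2 choose n) * exp (- 2 * real n * \<eta>\<^sup>2))" by simp
    also have "\<dots> \<le> s * (2 * (n\<^sup>2 choose n) * exp (- 2 * real n * \<eta>\<^sup>2))"
      using s[of \<omega>] unfolding T_def U_def by (intro mult_right_mono) auto
    finally show ?thesis .
  qed
  have cardS: "card S = n\<^sup>2 choose n" unfolding S_def using n_subsets[OF finU] cardU by simp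
  have ch: "real (n\<^sup>2 choose n) > 0" using nn by (simp add: zero_less_binomial)
  have "(n\<^sup>2 choose n) * ?b = (\<Sum>I'\<in>S. ?b)" by (simp add: cardS)
  also have "\<dots> \<le> (\<Sum>I'\<in>S. 2 * R.prob {\<omega>\<in>space R. Dev I' \<omega>})" by (rule sum_mono[OF ghost])
  also have "\<dots> = 2 * (\<Sum>I'\<in>S. R.expectation (indicator {\<omega>\<in>space R. Dev I' \<omega>}))"
    using Dev_meas by (simp add: sum_distrib_left S_def)
  also have "(\<Sum>I'\<in>S. R.expectation (indicator {\<omega>\<in>space R. Dev I' \<omega>}))
      = (R.expectation (\<lambda>\<omega>. \<Sum>I'\<in>S. indicator {\<omega>\<in>space R. Dev I' \<omega>} \<omega>) :: real)"
    using int_Dev by (intro Bochner_Integration.integral_sum[symmetric]) (auto simp: S_def)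
  also have "\<dots> \<le> R.expectation (\<lambda>\<omega>. s * (2 * (n\<^sup>2 choose n) * exp (- 2 * real n * \<eta>\<^sup>2)))"
  proof (rule integral_mono)
    show "integrable R (\<lambda>\<omega>. \<Sum>I'\<in>S. indicator {\<omega>\<in>space R. Dev I' \<omega>} \<omega> :: real)"
      using int_Dev by (intro Bochner_Integration.integrable_sum) (auto simp: S_def)
    fix \<omega> assume "\<omega> \<in> space R"
    then have "(\<Sum>I'\<in>S. indicator {\<omega>\<in>space R. Dev I' \<omega>} \<omega> :: real) = card {I'\<in>S. Dev I' \<omega>}"
      using finS by (simp add: indicator_def sum.If_cases Int_def)
    then show "(\<Sum>I'\<in>S. indicator {\<omega>\<in>space R. Dev I' \<omega>} \<omega>) \<le> s * (2 * (n\<^sup>2 choose n) * exp (- 2 * real n * \<eta>\<^sup>2))"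
      using count by simp
  qed simp
  finally have "(n\<^sup>2 choose n) * ?b \<le> (n\<^sup>2 choose n) * (4 * s * exp (- 2 * real n * \<eta>\<^sup>2))"
    by (simp add: R.prob_space mult_ac)
  then have "?b \<le> 4 * real s * exp (- 2 * real n * \<eta>\<^sup>2)" using ch by simp
  also have "\<dots> \<le> 4 * real s * exp (4 * e + 4 * e\<^sup>2 - 2 * real n * e\<^sup>2)"
  proof -
    have "n * (e\<^sup>2 - 2 * a * e - 2 * a * e\<^sup>2) \<le> n * \<eta>\<^sup>2"
      unfolding \<eta>_def using ghost_exponent_le[of e a] a e0 by (intro mult_left_mono) auto
    moreover have "n * (e\<^sup>2 - 2 * a * e - 2 * a * e\<^sup>2) = n * e\<^sup>2 - 2 * e - 2 * e\<^sup>2"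
      using n by (simp add: a_def field_simps)
    ultimately have "- 2 * real n * \<eta>\<^sup>2 \<le> 4 * e + 4 * e\<^sup>2 - 2 * real n * e\<^sup>2" by linarith
    then show ?thesis by (intro mult_left_mono) auto
  qed
  finally show ?thesis .
qed

section \<open>Bernstein's inequality\<close>

text \<open>Bernstein's estimate of \<open>exp x - 1 - x\<close> by
  \<open>x\<^sup>2 / (2 * (1 - x / 3))\<close> with the denominator cleared. The difference of the
  sides and its derivative vanish at 0, and the second derivative is nonnegative because
  \<open>1 - x \<le> exp (- x)\<close>.\<close>

lemma exp_second_order_le:
  fixes x :: real
  assumes "x \<ge> 0"
  shows "(1 - x / 3) * (exp x - 1 - x) \<le> x\<^sup>2 / 2"
proof -
  define g where "g = (\<lambda>x :: real. x\<^sup>2 / 2 - (1 - x / 3) * (exp x - 1 - x))"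
  define g' where "g' = (\<lambda>x :: real. x + (exp x - 1 - x) / 3 - (1 - x / 3) * (exp x - 1))"
  have d1: "(g has_real_derivative g' x) (at x)" for x
    unfolding g_def g'_def by (auto intro!: derivative_eq_intros simp: field_simps)
  have d2: "(g' has_real_derivative (1 + (x - 1) * exp x) / 3) (at x)" for x
    unfolding g'_def by (auto intro!: derivative_eq_intros simp: field_simps)
  have d2_nonneg: "(1 + (x - 1) * exp x) / 3 \<ge> 0" for x :: real
  proof -
    have "(1 - x) * exp x \<le> exp (- x) * exp x"
      using exp_ge_add_one_self[of "- x"] by (intro mult_right_mono) auto
    then show ?thesis by (simp add: algebra_simps flip: exp_add)
  qed
  have g'_nonneg: "g' y \<ge> 0" if "y \<ge> 0" for y
    using DERIV_nonneg_imp_nondecreasing[OF that, of g'] d2 d2_nonneg by (force simp: g'_def)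
  have "g x \<ge> g 0"
    using DERIV_nonneg_imp_nondecreasing[OF assms, of g] d1 g'_nonneg by blast
  then show ?thesis by (simp add: g_def)
qed

lemma exp_minus_second_order_le:
  fixes x :: real
  assumes "x \<ge> 0"
  shows "exp (- x) - 1 + x \<le> x\<^sup>2 / 2"
proof -
  define g where "g = (\<lambda>x :: real. x\<^sup>2 / 2 - (exp (- x) - 1 + x))"
  have "(g has_real_derivative (x + exp (- x) - 1)) (at x)" for x
    unfolding g_def by (auto intro!: derivative_eq_intros simp: field_simps)
  moreover have "x + exp (- x) - 1 \<ge> 0" for x :: real
    using exp_ge_add_one_self[of "- x"] by simp
  ultimately have "g x \<ge> g 0" using DERIV_nonneg_imp_nondecreasing[OF assms, of g] by blast
  then show ?thesis by (simp add: g_def)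
qed

lemma binomial_mgf_le:
  fixes p y :: real
  assumes "0 \<le> p" "p \<le> 1" "- 1 \<le> y"
  shows "(1 + p * y) ^ n \<le> exp (n * p * y)"
proof -
  have "p * y \<ge> - 1" using assms by (smt (verit) mult_left_le_one_le mult_nonneg_nonneg mult_minus_right mult_left_mono)
  then have "(1 + p * y) ^ n \<le> exp (p * y) ^ n"
    using exp_ge_add_one_self[of "p * y"] by (intro power_mono) auto
  then show ?thesis by (simp add: exp_of_nat_mult[symmetric] mult.assoc)
qed

text \<open>With Bernstein's parameter \<open>h\<close> the first exponent is
  \<open>- s\<^sup>2 / (2 * (m + s / 3))\<close>. The deviation \<open>s\<close> is chosen so that
  \<open>s\<^sup>2 \<ge> 2 * l * (m + s / 3)\<close>, which expanding both sides confirms.\<close>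

lemma Bernstein_exponent:
  fixes m l :: real
  assumes m: "m > 0" and l: "l > 0"
  defines "s \<equiv> sqrt (2 * m * l) + 2 / 3 * l"
  defines "h \<equiv> s / (m + s / 3)"
  shows "0 < h" "h < 3" "m * (h\<^sup>2 / (2 * (1 - h / 3))) - h * s \<le> - l" "m * (h\<^sup>2 / 2) - h * s \<le> - l"
proof -
  define r where "r = sqrt (2 * m * l)"
  have r: "r > 0" "r\<^sup>2 = 2 * m * l" using m l by (auto simp: r_def)
  have s: "s = r + 2 / 3 * l" by (simp add: s_def r_def)
  have "s > 0" using r l by (simp add: s)
  have D: "m + s / 3 > 0" using m \<open>s > 0\<close> by simp
  show h: "0 < h" using \<open>s > 0\<close> D by (simp add: h_def)
  show h3: "h < 3" using D m by (simp add: h_def pos_divide_less_eq)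
  have hD: "h * (m + s / 3) = s" using D by (simp add: h_def)
  have "s\<^sup>2 = 2 * m * l + 4 / 3 * l * r + 4 / 9 * l\<^sup>2"
    unfolding s power2_sum r(2) by (simp add: power2_eq_square)
  moreover have "2 * l * (m + s / 3) = 2 * m * l + 2 / 3 * l * r + 4 / 9 * l\<^sup>2"
    unfolding s by (simp add: power2_eq_square algebra_simps)
  ultimately have "2 * l * (m + s / 3) \<le> s\<^sup>2" using r l by simp
  also have "s\<^sup>2 = s * (h * (m + s / 3))" unfolding hD by (rule power2_eq_square)
  finally have "2 * l * (m + s / 3) \<le> (h * s) * (m + s / 3)" by (simp only: mult_ac)
  then have hs: "2 * l \<le> h * s" using D by simp
  have "(1 - h / 3) * (m + s / 3) = m" using hD by (simp add: algebra_simps)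
  then have m_eq: "m = (1 - h / 3) * (m + s / 3)" by simp
  have "m * (h\<^sup>2 / (2 * (1 - h / 3))) = (h * (m + s / 3)) * h / 2"
    using h3 by (subst m_eq) (simp add: field_simps power2_eq_square)
  then have eq: "m * (h\<^sup>2 / (2 * (1 - h / 3))) = h * s / 2" unfolding hD by simp
  then show "m * (h\<^sup>2 / (2 * (1 - h / 3))) - h * s \<le> - l" unfolding eq using hs by simp
  have "h\<^sup>2 / 2 \<le> h\<^sup>2 / (2 * (1 - h / 3))" using h h3 by (intro divide_left_mono) auto
  then have "m * (h\<^sup>2 / 2) \<le> m * (h\<^sup>2 / (2 * (1 - h / 3)))" using m by (intro mult_left_mono) auto
  then have "m * (h\<^sup>2 / 2) \<le> h * s / 2" unfolding eq .
  then show "m * (h\<^sup>2 / 2) - h * s \<le> - l" using hs by simp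
qed

text \<open>The mean \<open>m\<close> stands in for the variance of the count, by
  \<open>1 + x \<le> exp x\<close>. The term \<open>2 / 3 * l\<close> is the one that reappears in
  the second bound of the theorem.\<close>

lemma (in prob_space) hits_Bernstein:
  fixes p l m s :: real
  assumes ind: "indep_vars (\<lambda>_. N) X I" and I: "finite I" "I \<noteq> {}" and A: "A \<in> sets N"
    and p: "\<And>i. i \<in> I \<Longrightarrow> prob (X i -` A \<inter> space M) = p" and p0: "p > 0" and l: "l > 0"
  defines "m \<equiv> real (card I) * p"
  defines "s \<equiv> sqrt (2 * m * l) + 2 / 3 * l"
  shows "prob {\<omega>\<in>space M. m + s \<le> hits I A (\<lambda>i. X i \<omega>)} \<le> exp (- l)"
    and "prob {\<omega>\<in>space M. hits I A (\<lambda>i. X i \<omega>) \<le> m - s} \<le> exp (- l)"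
proof -
  have p1: "p \<le> 1" using p I by (metis ex_in_conv prob_le_1)
  have m: "m > 0" using p0 I by (simp add: m_def card_gt_0_iff)
  define h where "h = s / (m + s / 3)"
  note B = Bernstein_exponent[OF m l, folded s_def, folded h_def]
  have "prob {\<omega>\<in>space M. h * (m + s) \<le> h * hits I A (\<lambda>i. X i \<omega>)}
      \<le> exp (- (h * (m + s))) * (1 + p * (exp h - 1)) ^ card I"
    by (rule hits_Chernoff[OF ind I(1) A p])
  also have "\<dots> \<le> exp (- (h * (m + s))) * exp (card I * p * (exp h - 1))"
    using p0 p1 by (intro mult_left_mono binomial_mgf_le) auto
  also have "\<dots> = exp (m * (exp h - 1 - h) - h * s)" by (simp add: m_def algebra_simps flip: exp_add)
  also have "\<dots> \<le> exp (m * (h\<^sup>2 / (2 * (1 - h / 3))) - h * s)"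
  proof -
    have "exp h - 1 - h \<le> h\<^sup>2 / (2 * (1 - h / 3))"
    proof (rule mult_imp_le_div_pos)
      show "0 < 2 * (1 - h / 3)" using B(2) by simp
      show "(exp h - 1 - h) * (2 * (1 - h / 3)) \<le> h\<^sup>2"
        using exp_second_order_le[of h] B(1) by argo
    qed
    then have "m * (exp h - 1 - h) \<le> m * (h\<^sup>2 / (2 * (1 - h / 3)))" using m by (intro mult_left_mono) auto
    then show ?thesis by simp
  qed
  also have "\<dots> \<le> exp (- l)" using B(3) by simp
  finally show "prob {\<omega>\<in>space M. m + s \<le> hits I A (\<lambda>i. X i \<omega>)} \<le> exp (- l)"
    using B(1) by simp
  have "prob {\<omega>\<in>space M. - h * (m - s) \<le> - h * hits I A (\<lambda>i. X i \<omega>)}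
      \<le> exp (- (- h * (m - s))) * (1 + p * (exp (- h) - 1)) ^ card I"
    by (rule hits_Chernoff[OF ind I(1) A p])
  also have "\<dots> \<le> exp (- (- h * (m - s))) * exp (card I * p * (exp (- h) - 1))"
    using p0 p1 by (intro mult_left_mono binomial_mgf_le) auto
  also have "\<dots> = exp (m * (exp (- h) - 1 + h) - h * s)" by (simp add: m_def algebra_simps flip: exp_add)
  also have "\<dots> \<le> exp (m * (h\<^sup>2 / 2) - h * s)"
    using m exp_minus_second_order_le[of h] B(1) by (simp add: mult_left_mono)
  also have "\<dots> \<le> exp (- l)" using B(4) by simp
  finally show "prob {\<omega>\<in>space M. hits I A (\<lambda>i. X i \<omega>) \<le> m - s} \<le> exp (- l)"
    using B(1) by simp
qed

section \<open>Uniform deviations of an independent sample\<close>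

lemma (in prob_space) prob_box:
  assumes ind: "indep_vars (\<lambda>_. P) X I" and law: "\<And>i. i \<in> I \<Longrightarrow> distr M P (X i) = P"
    and I: "finite I" and B: "\<And>i. i \<in> I \<Longrightarrow> B i \<in> sets P"
  shows "prob {\<omega>\<in>space M. \<forall>i\<in>I. X i \<omega> \<in> B i} = (\<Prod>i\<in>I. measure P (B i))"
proof (cases "I = {}")
  case False
  have rv: "X i \<in> measurable M P" if "i \<in> I" for i using ind that by (auto simp: indep_vars_def)
  have "{\<omega>\<in>space M. \<forall>i\<in>I. X i \<omega> \<in> B i} = (\<Inter>i\<in>I. X i -` B i \<inter> space M)" using False by auto
  then have "prob {\<omega>\<in>space M. \<forall>i\<in>I. X i \<omega> \<in> B i} = (\<Prod>i\<in>I. prob (X i -` B i \<inter> space M))"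
    using indep_varsD_finite[OF ind False I B] by simp
  also have "\<dots> = (\<Prod>i\<in>I. measure P (B i))"
  proof (rule prod.cong[OF refl])
    fix i assume i: "i \<in> I"
    show "prob (X i -` B i \<inter> space M) = measure P (B i)"
      using measure_distr[OF rv[OF i] B[OF i]] unfolding law[OF i] ..
  qed
  finally show ?thesis .
qed (simp add: prob_space)

lemma (in prob_space) prob_deviation_eq_PiM:
  fixes c :: real and v :: "nat \<Rightarrow> real"
  assumes ind: "indep_vars (\<lambda>_. P) X I" and law: "\<And>i. i \<in> I \<Longrightarrow> distr M P (X i) = P"
    and I: "finite I" "I \<noteq> {}" and A: "\<And>j :: nat. A j \<in> sets P"
  shows "prob {\<omega>\<in>space M. \<exists>j. c < \<bar>hits I (A j) (\<lambda>i. X i \<omega>) - v j\<bar>}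
    = measure (PiM I (\<lambda>_. P)) {\<omega>\<in>space (PiM I (\<lambda>_. P)). \<exists>j. c < \<bar>hits I (A j) \<omega> - v j\<bar>}"
proof -
  have rv: "X i \<in> measurable M P" if "i \<in> I" for i using ind that by (auto simp: indep_vars_def)
  have "distr M (PiM I (\<lambda>_. P)) (\<lambda>\<omega>. \<lambda>i\<in>I. X i \<omega>) = PiM I (\<lambda>i. distr M P (X i))"
    using ind indep_vars_iff_distr_eq_PiM'[OF I(2) rv] by simp
  also have "\<dots> = PiM I (\<lambda>_. P)" using law by (intro PiM_cong) auto
  finally have dist: "distr M (PiM I (\<lambda>_. P)) (\<lambda>\<omega>. \<lambda>i\<in>I. X i \<omega>) = PiM I (\<lambda>_. P)" .
  have tm: "(\<lambda>\<omega>. \<lambda>i\<in>I. X i \<omega>) \<in> measurable M (PiM I (\<lambda>_. P))" using rv by (intro measurable_restrict)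
  have [measurable]: "(\<lambda>\<omega>. real (hits I (A j) \<omega>)) \<in> borel_measurable (PiM I (\<lambda>_. P))" for j
    using I A by (intro borel_measurable_hits_PiM) auto
  let ?B = "{\<omega>\<in>space (PiM I (\<lambda>_. P)). \<exists>j. c < \<bar>hits I (A j) \<omega> - v j\<bar>}"
  have "?B \<in> sets (PiM I (\<lambda>_. P))" by measurable
  from measure_distr[OF tm this] have "measure (PiM I (\<lambda>_. P)) ?B = prob ((\<lambda>\<omega>. \<lambda>i\<in>I. X i \<omega>) -` ?B \<inter> space M)"
    unfolding dist .
  also have "(\<lambda>\<omega>. \<lambda>i\<in>I. X i \<omega>) -` ?B \<inter> space M = {\<omega>\<in>space M. \<exists>j. c < \<bar>hits I (A j) (\<lambda>i. X i \<omega>) - v j\<bar>}"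
    using measurable_space[OF tm] by (auto cong: hits_cong)
  finally show ?thesis ..
qed

section \<open>Conditioning on which sample points lie in the tail\<close>

lemma prod_if_in_subset:
  fixes f :: "'i \<Rightarrow> real"
  assumes "finite I" "K \<subseteq> I"
  shows "(\<Prod>i\<in>I. if i \<in> K then f i else g i) = (\<Prod>i\<in>K. f i) * (\<Prod>i\<in>I - K. g i)"
proof -
  have "I \<inter> {i. i \<in> K} = K" "I \<inter> - {i. i \<in> K} = I - K" using assms by auto
  then show ?thesis using prod.If_cases[OF assms(1), of "\<lambda>i. i \<in> K" f g] by simp
qed

text \<open>On boxes the probability factors into \<open>P (T \<inter> B i)\<close> over
  \<open>K\<close> and \<open>P (space P - T)\<close> over \<open>I - K\<close>. Dividing by the
  probability of the index event cancels the second product and turns the first into that of the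
  conditional law; boxes determine a finite product measure.\<close>

lemma (in prob_space) prob_conditional_sample:
  assumes P: "prob_space P" and ind: "indep_vars (\<lambda>_. P) X I"
    and law: "\<And>i. i \<in> I \<Longrightarrow> distr M P (X i) = P"
    and I: "finite I" and K: "K \<subseteq> I" and T: "T \<in> sets P" "measure P T > 0"
    and F: "F \<in> sets (PiM K (\<lambda>_. uniform_measure P T))"
  shows "prob {\<omega>\<in>space M. {i\<in>I. X i \<omega> \<in> T} = K \<and> restrict (\<lambda>i. X i \<omega>) K \<in> F}
    = prob {\<omega>\<in>space M. {i\<in>I. X i \<omega> \<in> T} = K} * measure (PiM K (\<lambda>_. uniform_measure P T)) F"
proof -
  interpret P: prob_space P by (rule P)
  define Q where "Q = uniform_measure P T"
  have setsQ: "sets Q = sets P" by (simp add: Q_def)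
  interpret Q: prob_space Q
    unfolding Q_def using T by (intro prob_space_uniform_measure) (auto simp: P.emeasure_eq_measure)
  have finK: "finite K" using K I finite_subset by blast
  have rv: "X i \<in> measurable M P" if "i \<in> I" for i using ind that by (auto simp: indep_vars_def)
  define E where "E = {\<omega>\<in>space M. {i\<in>I. X i \<omega> \<in> T} = K}"
  define x where "x \<omega> = restrict (\<lambda>i. X i \<omega>) K" for \<omega>
  have x: "x \<in> measurable M (PiM K (\<lambda>_. Q))"
    unfolding x_def using rv K setsQ
    by (intro measurable_restrict) (auto cong: measurable_cong_sets)
  have F': "F \<in> sets (PiM K (\<lambda>_. Q))" using F by (simp add: Q_def)
  have box: "prob {\<omega>\<in>E. \<forall>i\<in>K. X i \<omega> \<in> B i} = (\<Prod>i\<in>K. P.prob (T \<inter> B i)) * (\<Prod>i\<in>I - K. P.prob (space P - T))"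
    if B: "\<And>i. i \<in> K \<Longrightarrow> B i \<in> sets P" for B
  proof -
    let ?C = "\<lambda>i. if i \<in> K then T \<inter> B i else space P - T"
    have "{\<omega>\<in>E. \<forall>i\<in>K. X i \<omega> \<in> B i} = {\<omega>\<in>space M. \<forall>i\<in>I. X i \<omega> \<in> ?C i}"
      using measurable_space[OF rv] K unfolding if_split_mem2 by (auto simp: E_def)
    then have "prob {\<omega>\<in>E. \<forall>i\<in>K. X i \<omega> \<in> B i} = (\<Prod>i\<in>I. P.prob (?C i))"
      using prob_box[OF ind law I, of ?C] B T by simp
    also have "\<dots> = (\<Prod>i\<in>I. if i \<in> K then P.prob (T \<inter> B i) else P.prob (space P - T))"
      by (intro prod.cong) auto
    finally show ?thesis by (simp only: prod_if_in_subset[OF I K])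
  qed
  have mem_if: "y \<in> (if b then T else space P - T) \<longleftrightarrow> (b \<longrightarrow> y \<in> T) \<and> (\<not> b \<longrightarrow> y \<in> space P - T)" for y b
    by simp
  have E_eq: "E = {\<omega>\<in>space M. \<forall>i\<in>I. X i \<omega> \<in> (if i \<in> K then T else space P - T)}"
    using measurable_space[OF rv] K unfolding mem_if by (auto simp: E_def)
  have E_sets: "E \<in> events"
  proof -
    have "E = space M \<inter> (\<Inter>i\<in>I. {\<omega>\<in>space M. X i \<omega> \<in> (if i \<in> K then T else space P - T)})"
      unfolding E_eq by blast
    moreover have "{\<omega>\<in>space M. X i \<omega> \<in> (if i \<in> K then T else space P - T)} \<in> events" if "i \<in> I" for i
    proof -
      have "(if i \<in> K then T else space P - T) \<in> sets P" using T by simp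
      from measurable_sets[OF rv[OF that] this] show ?thesis
        by (simp only: vimage_def Int_def mem_Collect_eq conj_commute)
    qed
    ultimately show ?thesis using I by (cases "I = {}") (auto intro!: sets.Int sets.finite_INT)
  qed
  have probE: "prob E = (\<Prod>i\<in>K. P.prob T) * (\<Prod>i\<in>I - K. P.prob (space P - T))"
    using box[of "\<lambda>_. space P"] measurable_space[OF rv] K T(1)[THEN sets.sets_into_space]
    by (simp add: E_def Int_absorb2 subset_iff cong: conj_cong)
  have "prob (E \<inter> (x -` F \<inter> space M)) = prob E * measure (PiM K (\<lambda>_. Q)) F"
  proof (cases "prob E = 0")
    case True
    have "prob (E \<inter> (x -` F \<inter> space M)) \<le> prob E"
      using E_sets by (intro finite_measure_mono) auto
    then show ?thesis using True by (simp add: measure_le_0_iff)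
  next
    case False
    then have pE: "prob E > 0" by (simp add: zero_less_measure_iff)
    define ME where "ME = uniform_measure M E"
    have setsME: "sets ME = sets M" by (simp add: ME_def)
    interpret ME: prob_space ME
      unfolding ME_def using pE by (intro prob_space_uniform_measure) (auto simp: emeasure_eq_measure)
    have ME: "measure ME S = prob (E \<inter> S) / prob E" if "S \<in> events" for S
      unfolding ME_def using that pE by (intro measure_uniform_measure) (auto simp: emeasure_eq_measure)
    have x': "x \<in> measurable ME (PiM K (\<lambda>_. Q))" using x setsME by (simp cong: measurable_cong_sets)
    interpret PQ: product_prob_space "\<lambda>_. Q" K by unfold_locales
    have "distr ME (PiM K (\<lambda>_. Q)) x = PiM K (\<lambda>_. Q)"
    proof (rule PQ.PiM_eqI[OF finK])
      fix B assume B: "\<And>i. i \<in> K \<Longrightarrow> B i \<in> sets Q"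
      have Bs: "Pi\<^sub>E K B \<in> sets (PiM K (\<lambda>_. Q))" using B finK by (intro sets_PiM_I_finite) auto
      have "emeasure (distr ME (PiM K (\<lambda>_. Q)) x) (Pi\<^sub>E K B) = measure ME (x -` Pi\<^sub>E K B \<inter> space ME)"
        using emeasure_distr[OF x' Bs] ME.emeasure_eq_measure by simp
      also have "measure ME (x -` Pi\<^sub>E K B \<inter> space ME) = prob (E \<inter> (x -` Pi\<^sub>E K B \<inter> space M)) / prob E"
        using ME[OF measurable_sets[OF x Bs]] by (simp add: ME_def)
      also have "E \<inter> (x -` Pi\<^sub>E K B \<inter> space M) = {\<omega>\<in>E. \<forall>i\<in>K. X i \<omega> \<in> B i}"
        by (auto simp: E_def x_def PiE_iff)
      also have "prob \<dots> = (\<Prod>i\<in>K. P.prob (T \<inter> B i)) * (\<Prod>i\<in>I - K. P.prob (space P - T))"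
        using B setsQ by (intro box) auto
      also have "\<dots> / prob E = (\<Prod>i\<in>K. P.prob (T \<inter> B i) / P.prob T)"
      proof -
        have "(\<Prod>i\<in>I - K. P.prob (space P - T)) \<noteq> 0" using pE unfolding probE by (metis mult_zero_right less_irrefl)
        then show ?thesis unfolding prod_dividef probE by (rule mult_divide_mult_cancel_right)
      qed
      also have "\<dots> = (\<Prod>i\<in>K. Q.prob (B i))"
      proof (rule prod.cong[OF refl])
        fix i assume "i \<in> K"
        then have "B i \<in> sets P" using B setsQ by auto
        then show "P.prob (T \<inter> B i) / P.prob T = Q.prob (B i)"
          unfolding Q_def using T by (intro measure_uniform_measure[symmetric]) (auto simp: P.emeasure_eq_measure)
      qed
      finally show "emeasure (distr ME (PiM K (\<lambda>_. Q)) x) (Pi\<^sub>E K B) = (\<Prod>i\<in>K. emeasure Q (B i))"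
        by (simp add: Q.emeasure_eq_measure prod_ennreal)
    qed simp
    then have "measure (PiM K (\<lambda>_. Q)) F = measure ME (x -` F \<inter> space ME)"
      using measure_distr[OF x' F'] by simp
    also have "\<dots> = prob (E \<inter> (x -` F \<inter> space M)) / prob E"
      using ME[OF measurable_sets[OF x F']] by (simp add: ME_def)
    finally show ?thesis using pE by simp
  qed
  moreover have "E \<inter> (x -` F \<inter> space M)
      = {\<omega>\<in>space M. {i\<in>I. X i \<omega> \<in> T} = K \<and> restrict (\<lambda>i. X i \<omega>) K \<in> F}"
    by (auto simp: E_def x_def)
  ultimately show ?thesis by (simp add: E_def Q_def)
qed

text \<open>A polynomial bound on the shatter function of the family, in the form that polar caps
  satisfy when \<open>d\<close> is the dimension.\<close>

definition growth_le :: "nat \<Rightarrow> (nat \<Rightarrow> 'a set) \<Rightarrow> bool" where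
  "growth_le d A \<longleftrightarrow>
     (\<forall>N (x :: nat \<Rightarrow> 'a). card (range (\<lambda>j. {i\<in>{..<N}. x i \<in> A j})) \<le> 3 * N ^ d + 1)"

text \<open>The pool has \<open>n\<^sup>2\<close> points, which doubles the degree \<open>d\<close>;
  and \<open>4 * e + 4 * e\<^sup>2 \<le> 8\<close> for \<open>e \<le> 1\<close> is the origin of the
  constant \<open>exp 8\<close>.\<close>

lemma Devroye_inequality_growth:
  fixes A :: "nat \<Rightarrow> 'a set" and I :: "'i set" and e :: real
  assumes "prob_space Q" "\<And>j. A j \<in> sets Q" "finite I" "card I = n" "n \<ge> 4"
    "1 < n * e" "e \<le> 1" "growth_le d A"
  shows "measure (PiM I (\<lambda>_. Q))
      {\<omega>\<in>space (PiM I (\<lambda>_. Q)). \<exists>j. n * e < \<bar>hits I (A j) \<omega> - n * measure Q (A j)\<bar>}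
    \<le> 4 * (3 * real n ^ (2 * d) + 1) * exp 8 * exp (- (2 * real n * e\<^sup>2))"
proof -
  have e0: "e \<ge> 0" using assms(5,6) by (smt (verit) mult_nonneg_nonpos of_nat_0_le_iff)
  have "measure (PiM I (\<lambda>_. Q))
      {\<omega>\<in>space (PiM I (\<lambda>_. Q)). \<exists>j. n * e < \<bar>hits I (A j) \<omega> - n * measure Q (A j)\<bar>}
    \<le> 4 * real (3 * (n\<^sup>2) ^ d + 1) * exp (4 * e + 4 * e\<^sup>2 - 2 * real n * e\<^sup>2)"
    using assms unfolding growth_le_def by (intro Devroye_inequality) auto
  also have "\<dots> \<le> 4 * real (3 * (n\<^sup>2) ^ d + 1) * exp (8 - 2 * real n * e\<^sup>2)"
  proof -
    have "e\<^sup>2 \<le> 1" using e0 assms(7) by (simp add: power_le_one)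
    then have "4 * e + 4 * e\<^sup>2 - 2 * real n * e\<^sup>2 \<le> 8 - 2 * real n * e\<^sup>2" using assms(7) by linarith
    then show ?thesis by (intro mult_left_mono) auto
  qed
  also have "\<dots> = 4 * (3 * real n ^ (2 * d) + 1) * exp 8 * exp (- (2 * real n * e\<^sup>2))"
    by (simp add: power_mult exp_diff exp_minus divide_inverse)
  finally show ?thesis .
qed

lemma hits_deviation_le:
  assumes "prob_space Q" "finite I" "card I = n"
  shows "\<bar>hits I A x - n * measure Q A\<bar> \<le> n"
proof -
  interpret Q: prob_space Q by (rule assms(1))
  have "real (hits I A x) \<le> n" using hits_le_card[OF assms(2), of A x] assms(3) by simp
  moreover have "real n * Q.prob A \<le> n" by (simp add: mult_left_le)
  moreover have "0 \<le> real n * Q.prob A" by simp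
  ultimately show ?thesis by linarith
qed

text \<open>For \<open>e > 1\<close> the event is empty, since frequencies and probabilities differ
  by at most 1. Otherwise \<open>exp (- 2 * n * e\<^sup>2)\<close> is
  \<open>(\<delta> / n) ^ (2 * d)\<close>. The trace factor is at most
  \<open>16 * n ^ (2 * d)\<close>, and rounding it up to 17 makes the final inequality
  strict.\<close>

lemma (in prob_space) prob_uniform_deviation_lt:
  fixes \<delta> :: real and A :: "nat \<Rightarrow> 'b set"
  assumes P: "prob_space P" and ind: "indep_vars (\<lambda>_. P) X I"
    and law: "\<And>i. i \<in> I \<Longrightarrow> distr M P (X i) = P" and I: "finite I" "card I = n" and n: "n \<ge> 4"
    and A: "\<And>j. A j \<in> sets P" and growth: "growth_le d A" and d: "d \<ge> 1"
    and \<delta>: "0 < \<delta>" "\<delta> < 1" "\<delta> ^ (2 * d - 1) \<le> 1 / (17 * exp 8)"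
  defines "e \<equiv> sqrt (d * ln (n / \<delta>) / n)"
  shows "prob {\<omega>\<in>space M. \<exists>j. n * e < \<bar>hits I (A j) (\<lambda>i. X i \<omega>) - n * measure P (A j)\<bar>} < \<delta>"
proof (cases "e \<le> 1")
  case False
  have "real n * 1 \<le> n * e" using False by (intro mult_left_mono) auto
  then have "\<not> n * e < \<bar>hits I (A j) (\<lambda>i. X i \<omega>) - n * measure P (A j)\<bar>" for j \<omega>
    using hits_deviation_le[OF P I, of "A j" "\<lambda>i. X i \<omega>"] by linarith
  then show ?thesis using \<delta> by simp
next
  case True
  \<comment> \<open>The logarithm must exceed 1 to give \<open>n * e\<^sup>2 > 1\<close>; together
    with \<open>e \<le> 1\<close> this yields \<open>1 < n * e\<close>, a premise of Devroye's
    inequality.\<close>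
  have "exp 1 \<le> (3 :: real)" by (rule exp_le)
  also have "\<dots> < n / \<delta>" using n \<delta> by (simp add: pos_less_divide_eq)
  finally have "exp 1 < n / \<delta>" .
  then have "ln (exp 1) < ln (n / \<delta>)" using n \<delta> by (subst ln_less_cancel_iff) auto
  then have ln: "1 < ln (n / \<delta>)" by simp
  have "1 * 1 < d * ln (n / \<delta>)" using d ln by (intro mult_le_less_imp_less) auto
  then have ne2: "n * e\<^sup>2 = d * ln (n / \<delta>)" "1 < n * e\<^sup>2" using n by (simp_all add: e_def)
  have e0: "e \<ge> 0" using n \<delta> ln by (simp add: e_def)
  have "e\<^sup>2 \<le> e" using e0 True by (simp add: power2_eq_square mult_left_le)
  then have "n * e\<^sup>2 \<le> n * e" by (intro mult_left_mono) auto
  then have ne: "1 < n * e" using ne2 by linarith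
  have Ine: "I \<noteq> {}" using I n by auto
  have "prob {\<omega>\<in>space M. \<exists>j. n * e < \<bar>hits I (A j) (\<lambda>i. X i \<omega>) - n * measure P (A j)\<bar>}
      \<le> 4 * (3 * real n ^ (2 * d) + 1) * exp 8 * exp (- (2 * real n * e\<^sup>2))"
    using Devroye_inequality_growth[OF P A I n ne True growth]
    by (subst prob_deviation_eq_PiM[OF ind law I(1) Ine A]) simp_all
  also have "exp (- (2 * real n * e\<^sup>2)) = (\<delta> / n) ^ (2 * d)"
  proof -
    have "- (2 * real n * e\<^sup>2) = of_nat (2 * d) * ln (\<delta> / n)"
      using n \<delta> ne2(1) by (simp add: ln_div algebra_simps)
    then show ?thesis using n \<delta> by (simp only: exp_of_nat_mult) simp
  qed
  also have "4 * (3 * real n ^ (2 * d) + 1) * exp 8 * (\<delta> / n) ^ (2 * d) < 17 * real n ^ (2 * d) * exp 8 * (\<delta> / n) ^ (2 * d)"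
  proof -
    have "4 * (3 * y + 1) < 17 * y" if "1 \<le> y" for y :: real using that by simp
    from this[of "real n ^ (2 * d)"] have "4 * (3 * real n ^ (2 * d) + 1) < 17 * real n ^ (2 * d)"
      using n by (simp add: one_le_power)
    then show ?thesis using n \<delta> by (intro mult_strict_right_mono) auto
  qed
  also have "\<dots> = (17 * exp 8 * \<delta> ^ (2 * d - 1)) * \<delta>"
    using n d by (simp add: power_divide flip: power_Suc2)
  also have "\<dots> \<le> 1 * \<delta>" using \<delta> by (intro mult_right_mono) (auto simp: field_simps)
  finally show ?thesis by simp
qed

section \<open>Numerical estimates for small and large expected numbers of tail points\<close>

context
  fixes d :: nat and m \<delta> L l l1 R s :: real
  assumes d: "d \<ge> 2" and m: "m > 0" and \<delta>: "0 < \<delta>" "\<delta> < 1" "\<delta> ^ d \<le> 1 / 32"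
  defines "L \<equiv> ln ((m + 1) / \<delta>)" and "l \<equiv> ln (1 / \<delta>)" and "l1 \<equiv> ln (4 / \<delta>)"
    and "R \<equiv> sqrt (d * L * m)" and "s \<equiv> sqrt (2 * m * l1) + 2 / 3 * l1"
begin

lemma log_bounds: "0 < l" "l \<le> L" "2 * L \<le> d * L" "l1 = l + ln 4"
proof -
  show l: "0 < l" using \<delta> by (simp add: l_def)
  show lL: "l \<le> L" unfolding l_def L_def using \<delta> m by (subst ln_le_cancel_iff) (auto simp: divide_right_mono)
  show "2 * L \<le> d * L" using d l lL by (intro mult_right_mono) auto
  show "l1 = l + ln 4" using \<delta> by (simp add: l_def l1_def ln_div)
qed

text \<open>Here \<open>m \<le> 2 * R\<close> because \<open>m\<close> is small, and
  \<open>sqrt (2 * m * l) \<le> R\<close> because \<open>2 * l \<le> d * L\<close>; together they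
  use up exactly \<open>3 * R\<close>.\<close>

lemma small_mean_threshold:
  assumes "m \<le> 4 * (d * L)"
  shows "m + (sqrt (2 * m * l) + 2 / 3 * l) \<le> 3 * R + 2 / 3 * l"
proof -
  have "(m / 2)\<^sup>2 \<le> d * L * m" using assms m by (simp add: power2_eq_square mult_right_mono)
  then have "m / 2 \<le> R" unfolding R_def by (rule real_le_rsqrt)
  moreover have "2 * l \<le> d * L" using log_bounds by linarith
  then have "2 * l * m \<le> d * L * m" using m by (intro mult_right_mono) auto
  then have "sqrt (2 * m * l) \<le> R"
    unfolding R_def by (intro real_sqrt_le_mono) (simp add: mult_ac)
  ultimately show ?thesis by simp
qed

context
  assumes large: "4 * (d * L) < m"
begin

text \<open>A bootstrap: \<open>\<delta> ^ d \<le> 1 / 32\<close> gives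
  \<open>d * L \<ge> d * ln (m + 1) + 3\<close>, while \<open>m > 4 * (d * L)\<close>. From
  \<open>d * L \<ge> 3\<close> follows \<open>m > 12\<close>, so \<open>m + 1 \<ge> exp 2\<close>
  and \<open>d * L \<ge> 7\<close>; then \<open>m > 28\<close>, so \<open>m + 1 \<ge> exp 3\<close>
  and \<open>d * L \<ge> 9\<close>.\<close>

lemma large_mean_bounds: "9 \<le> d * L" "36 < m" "l1 \<le> L" "18 \<le> R" "R \<le> m / 2" "R\<^sup>2 = d * L * m"
proof -
  have dL: "d * L = d * ln (m + 1) - ln (\<delta> ^ d)"
    using \<delta> m by (simp add: L_def ln_div ln_realpow algebra_simps)
  have e3: "exp 3 \<le> (27 :: real)"
    using power_mono[OF exp_le, of 3] by (simp flip: exp_of_nat_mult)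
  have e2: "exp 2 \<le> (9 :: real)"
    using power_mono[OF exp_le, of 2] by (simp flip: exp_of_nat_mult)
  have "ln (\<delta> ^ d) \<le> ln (1 / 32)" using \<delta> by (subst ln_le_cancel_iff) auto
  also have "\<dots> = - ln 32" by (simp add: ln_div)
  also have "\<dots> \<le> - 3" using e3 by (simp add: ln_ge_iff)
  finally have base: "d * L \<ge> d * ln (m + 1) + 3" using dL by linarith
  have step: "2 * c \<le> d * ln (m + 1)" if "exp c \<le> m + 1" "c \<ge> 0" for c
    using that d m by (intro mult_mono) (auto simp: ln_ge_iff)
  have "d * ln (m + 1) \<ge> 0" using m by simp
  then have "d * L \<ge> 3" using base by linarith
  then have "exp 2 \<le> m + 1" using large e2 by linarith
  then have "d * L \<ge> 7" using base step[of 2] by linarith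
  then have e3m: "exp 3 \<le> m + 1" using large e3 by linarith
  then show dL9: "9 \<le> d * L" using base step[of 3] by linarith
  then show m36: "36 < m" using large by linarith
  show "l1 \<le> L" unfolding l1_def L_def using \<delta> m36 by (subst ln_le_cancel_iff) (auto simp: divide_right_mono)
  show R2: "R\<^sup>2 = d * L * m" unfolding R_def using dL9 m36 by simp
  have "9 * 36 \<le> d * L * m" using dL9 m36 by (intro mult_mono) auto
  then show "18 \<le> R" unfolding R_def by (intro real_le_rsqrt) simp
  have "d * L * m \<le> (m / 2)\<^sup>2" using large m by (simp add: power2_eq_square mult_right_mono)
  then show "R \<le> m / 2" unfolding R_def using m by (intro real_le_lsqrt) auto
qed

text \<open>Replacing \<open>l\<close> by \<open>l1\<close> adds \<open>2 / 3 * ln 4\<close>, which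
  is below \<open>R / 5\<close> since \<open>R \<ge> 18\<close>; with
  \<open>sqrt (2 * m * l1) \<le> R\<close> the fluctuation of the count takes at most
  \<open>6 / 5 * R + 2 / 3 * l\<close>.\<close>

lemma large_mean_s: "0 < l1" "s \<le> 3 * R + 2 / 3 * l - 9 / 5 * R" "m + s \<le> 8 / 5 * m"
proof -
  note B = large_mean_bounds log_bounds
  show "0 < l1" using B(10) B(7) ln_gt_zero[of "4 :: real"] by linarith
  have e: "exp 2 \<ge> (4 :: real)"
    using exp_ge_add_one_self[of "1 :: real"] power_mono[of 2 "exp 1 :: real" 2] by (simp flip: exp_of_nat_mult)
  have "ln 4 \<le> ln (exp 2 :: real)" using e by (subst ln_le_cancel_iff) auto
  then have "ln 4 \<le> (2 :: real)" by simp
  moreover have sq: "sqrt (2 * m * l1) \<le> R"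
  proof -
    have "2 * l1 \<le> d * L" using B by linarith
    then have "2 * l1 * m \<le> d * L * m" using m by (intro mult_right_mono) auto
    then show ?thesis unfolding R_def by (intro real_sqrt_le_mono) (simp add: mult_ac)
  qed
  ultimately show "s \<le> 3 * R + 2 / 3 * l - 9 / 5 * R" using B unfolding s_def by linarith
  show "m + s \<le> 8 / 5 * m" using B sq large unfolding s_def by linarith
qed

text \<open>The share 9/5 is large enough because \<open>2 * (9 / 5)\<^sup>2 = 162 / 25\<close>
  exceeds \<open>4 * 8 / 5\<close>: as \<open>k \<le> 8 / 5 * m\<close>, the exponential is at most
  \<open>(\<delta> / w) ^ (4 * d)\<close> with \<open>w = m + 1\<close>. One factor
  \<open>w ^ (2 * d)\<close> absorbs the number of traces, the other absorbs \<open>exp 8\<close>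
  and the remaining constants, thanks to \<open>w \<ge> 37\<close>.\<close>

lemma large_mean_Devroye:
  fixes k :: nat
  assumes k: "k < m + s" "9 / 5 * R \<le> k"
  shows "k \<ge> 4"
    and "4 * (3 * real k ^ (2 * d) + 1) * exp 8 * exp (- (2 * real k * (9 / 5 * R / k)\<^sup>2)) \<le> \<delta> / 2"
proof -
  note B = large_mean_bounds log_bounds
  show k4: "k \<ge> 4" using B(4) k(2) by linarith
  define w where "w = m + 1"
  have w: "37 \<le> w" using B(2) by (simp add: w_def)
  have km: "k \<le> 8 / 5 * m" using k(1) large_mean_s(3) by linarith
  have "4 * (d * L) * k \<le> 4 * (d * L) * (8 / 5 * m)" using B(1) km by (intro mult_left_mono) auto
  also have "\<dots> = 32 / 5 * R\<^sup>2" unfolding B(6) by simp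
  also have "\<dots> \<le> 162 / 25 * R\<^sup>2" by simp
  finally have "4 * (d * L) \<le> 2 * real k * (9 / 5 * R / k)\<^sup>2"
    using k4 by (simp add: power2_eq_square field_simps)
  then have "exp (- (2 * real k * (9 / 5 * R / k)\<^sup>2)) \<le> exp (- (4 * (d * L)))" by simp
  also have "- (4 * (d * L)) = of_nat (4 * d) * ln (\<delta> / w)"
    using \<delta> w by (simp add: L_def w_def ln_div algebra_simps)
  also have "exp \<dots> = (\<delta> / w) ^ (4 * d)" using \<delta> w by (simp only: exp_of_nat_mult) simp
  also have "\<dots> = \<delta> ^ (4 * d) / w ^ (2 * d) / w ^ (2 * d)" by (simp add: power_divide flip: power_add)
  also have "\<dots> \<le> \<delta> / w ^ (2 * d) / w ^ (2 * d)"
    using \<delta> d w power_decreasing[of 1 "4 * d" \<delta>] by (intro divide_right_mono) auto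
  finally have ex: "exp (- (2 * real k * (9 / 5 * R / k)\<^sup>2)) \<le> \<delta> / w ^ (2 * d) / w ^ (2 * d)" .
  have "4 * (3 * y + 1) \<le> 16 * y" if "1 \<le> y" for y :: real using that by simp
  from this[of "real k ^ (2 * d)"] have "4 * (3 * real k ^ (2 * d) + 1) \<le> 16 * real k ^ (2 * d)"
    using k4 by (simp add: one_le_power)
  also have "real k ^ (2 * d) \<le> (8 / 5 * w) ^ (2 * d)" using km m by (intro power_mono) (auto simp: w_def)
  finally have kk: "4 * (3 * real k ^ (2 * d) + 1) \<le> 16 * ((8 / 5) ^ (2 * d) * w ^ (2 * d))"
    by (simp only: power_mult_distrib)
  have e8: "exp 8 \<le> (6561 :: real)" using power_mono[OF exp_le, of 8] by (simp flip: exp_of_nat_mult)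
  have "4 * (3 * real k ^ (2 * d) + 1) * exp 8 * exp (- (2 * real k * (9 / 5 * R / k)\<^sup>2))
      \<le> 16 * ((8 / 5) ^ (2 * d) * w ^ (2 * d)) * 6561 * (\<delta> / w ^ (2 * d) / w ^ (2 * d))"
    by (intro mult_mono kk e8 ex) (use \<delta> w in auto)
  also have "\<dots> = 104976 * (8 / 5 / w) ^ (2 * d) * \<delta>"
    using w by (simp add: power_divide)
  also have "\<dots> \<le> 104976 * (1 / 22) ^ 4 * \<delta>"
  proof -
    have "(8 / 5 / w) ^ (2 * d) \<le> (1 / 22) ^ (2 * d)" using w by (intro power_mono) (auto simp: field_simps)
    also have "\<dots> \<le> (1 / 22) ^ 4" using d by (intro power_decreasing) auto
    finally show ?thesis using \<delta> by (intro mult_right_mono mult_left_mono) auto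
  qed
  also have "\<dots> \<le> \<delta> / 2" using \<delta> by (simp add: power_divide)
  finally show "4 * (3 * real k ^ (2 * d) + 1) * exp 8 * exp (- (2 * real k * (9 / 5 * R / k)\<^sup>2)) \<le> \<delta> / 2" .
qed

end

end

lemma (in prob_space) prob_tail_deviation_le:
  fixes \<delta> :: real and A :: "nat \<Rightarrow> 'b set" and d n :: nat
  assumes P: "prob_space P" and ind: "indep_vars (\<lambda>_. P) X I"
    and law: "\<And>i. i \<in> I \<Longrightarrow> distr M P (X i) = P" and I: "finite I" "card I = n" and n: "n \<ge> 1"
    and T: "T \<in> sets P" "measure P T > 0"
    and A: "\<And>j. A j \<in> sets P" "\<And>j. A j \<subseteq> T" and growth: "growth_le d A" and d: "d \<ge> 2"
    and \<delta>: "0 < \<delta>" "\<delta> < 1" "\<delta> ^ d \<le> 1 / 32"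
  defines "m \<equiv> n * measure P T"
  shows "prob {\<omega>\<in>space M. \<exists>j. 3 * sqrt (d * ln ((m + 1) / \<delta>) * m) + 2 / 3 * ln (1 / \<delta>)
      < \<bar>hits I (A j) (\<lambda>i. X i \<omega>) - n * measure P (A j)\<bar>} \<le> \<delta>"
proof -
  interpret P: prob_space P by (rule P)
  define q where "q = P.prob T"
  have q: "q > 0" using T by (simp add: q_def)
  have m_eq: "m = real (card I) * q" by (simp add: m_def q_def I)
  have m: "m > 0" using n q by (simp add: m_def q_def)
  have Ine: "I \<noteq> {}" using I n by auto
  have rv: "X i \<in> measurable M P" if "i \<in> I" for i using ind that by (auto simp: indep_vars_def)
  define L where "L = ln ((m + 1) / \<delta>)"
  define l where "l = ln (1 / \<delta>)"
  \<comment> \<open>For large \<open>m\<close> each of the two Bernstein tails may fail with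
    probability \<open>\<delta> / 4\<close>, which leaves \<open>\<delta> / 2\<close> for Devroye's
    inequality. For small \<open>m\<close> a single tail at level \<open>l\<close> may use all of
    \<open>\<delta>\<close>.\<close>
  define l1 where "l1 = ln (4 / \<delta>)"
  define R where "R = sqrt (d * L * m)"
  define s where "s = sqrt (2 * m * l1) + 2 / 3 * l1"
  define K where "K \<omega> = real (hits I T (\<lambda>i. X i \<omega>))" for \<omega>
  define Bad where "Bad = {\<omega>\<in>space M. \<exists>j. 3 * R + 2 / 3 * l < \<bar>hits I (A j) (\<lambda>i. X i \<omega>) - n * P.prob (A j)\<bar>}"
  have [measurable]: "K \<in> borel_measurable M"
    unfolding K_def using I rv T by (intro borel_measurable_hits) auto
  have pT: "prob (X i -` T \<inter> space M) = q" if "i \<in> I" for i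
    using measure_distr[OF rv[OF that] T(1)] unfolding law[OF that] q_def ..
  note nums = d m \<delta>
  note lb = log_bounds[OF nums, folded L_def l_def l1_def]
  have AT: "P.prob (A j) \<le> q" for j unfolding q_def using A T by (intro P.finite_measure_mono) auto
  have "prob Bad \<le> \<delta>"
  proof (cases "m \<le> 4 * (d * L)")
    case True
    note thr = small_mean_threshold[OF nums, folded L_def l_def, folded R_def, OF True]
    \<comment> \<open>Count and mean of \<open>A j\<close> lie in \<open>[0, K]\<close> and
      \<open>[0, m]\<close>, so the deviation is at most the larger of \<open>K\<close> and
      \<open>m\<close>. The threshold is at least \<open>m\<close>, hence a violation must be due to
      \<open>K\<close>.\<close>
    have "Bad \<subseteq> {\<omega>\<in>space M. m + (sqrt (2 * m * l) + 2 / 3 * l) \<le> K \<omega>}"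
    proof
      fix \<omega> assume "\<omega> \<in> Bad"
      then obtain j where w: "\<omega> \<in> space M"
        and j: "3 * R + 2 / 3 * l < \<bar>hits I (A j) (\<lambda>i. X i \<omega>) - n * P.prob (A j)\<bar>"
        by (auto simp: Bad_def)
      have "real (hits I (A j) (\<lambda>i. X i \<omega>)) \<le> K \<omega>"
        unfolding K_def using hits_mono[OF I(1) A(2)] by simp
      moreover have "n * P.prob (A j) \<le> m" unfolding m_eq I(2) using AT by (intro mult_left_mono) auto
      moreover have "0 \<le> n * P.prob (A j)" "0 \<le> real (hits I (A j) (\<lambda>i. X i \<omega>))" by auto
      moreover have "0 \<le> sqrt (2 * m * l) + 2 / 3 * l" using m lb by simp
      ultimately have "m + (sqrt (2 * m * l) + 2 / 3 * l) \<le> K \<omega>" using thr j by linarith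
      then show "\<omega> \<in> {\<omega>\<in>space M. m + (sqrt (2 * m * l) + 2 / 3 * l) \<le> K \<omega>}" using w by simp
    qed
    then have "prob Bad \<le> prob {\<omega>\<in>space M. m + (sqrt (2 * m * l) + 2 / 3 * l) \<le> K \<omega>}"
      by (intro finite_measure_mono) auto
    also have "\<dots> \<le> exp (- l)"
      using hits_Bernstein(1)[OF ind I(1) Ine T(1) pT q lb(1)] unfolding K_def m_eq .
    also have "\<dots> = \<delta>" using \<delta> by (simp add: l_def exp_minus)
    finally show ?thesis .
  next
    case False
    then have large: "4 * (d * L) < m" by simp
    note B = large_mean_bounds[OF nums, folded L_def l1_def, folded R_def, OF large]
    note S = large_mean_s[OF nums, folded L_def l_def l1_def, folded R_def s_def, OF large]
    note Dev = large_mean_Devroye[OF nums, folded L_def l1_def, folded R_def s_def, OF large]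
    have exp_l1: "exp (- l1) = \<delta> / 4" using \<delta> by (simp add: l1_def exp_minus)
    define U1 where "U1 = {\<omega>\<in>space M. m + s \<le> K \<omega>}"
    define U2 where "U2 = {\<omega>\<in>space M. K \<omega> \<le> m - s}"
    have U: "U1 \<in> events" "U2 \<in> events" unfolding U1_def U2_def by measurable
    have U1: "prob U1 \<le> \<delta> / 4" and U2: "prob U2 \<le> \<delta> / 4"
      using hits_Bernstein[OF ind I(1) Ine T(1) pT q S(1)] exp_l1
      unfolding U1_def U2_def K_def m_eq s_def by simp_all
    define Q where "Q = uniform_measure P T"
    have setsQ: "sets Q = sets P" by (simp add: Q_def)
    have Q: "prob_space Q"
      unfolding Q_def using T by (intro prob_space_uniform_measure) (auto simp: P.emeasure_eq_measure)
    interpret Q: prob_space Q by (rule Q)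
    have QA: "Q.prob (A j) = P.prob (A j) / q" for j
    proof -
      have "Q.prob (A j) = P.prob (T \<inter> A j) / P.prob T"
        unfolding Q_def using T A by (intro measure_uniform_measure) (auto simp: P.emeasure_eq_measure)
      also have "T \<inter> A j = A j" using A by auto
      finally show ?thesis by (simp add: q_def)
    qed
    define F where "F J = {x\<in>space (PiM J (\<lambda>_. Q)). \<exists>j. 9 / 5 * R < \<bar>hits J (A j) x - card J * Q.prob (A j)\<bar>}" for J :: "'c set"
    define E where "E J = {\<omega>\<in>space M. {i\<in>I. X i \<omega> \<in> T} = J}" for J
    define W where "W J = {\<omega>\<in>space M. {i\<in>I. X i \<omega> \<in> T} = J \<and> restrict (\<lambda>i. X i \<omega>) J \<in> F J}" for J
    \<comment> \<open>The index sets of typical size. The events \<open>E J\<close> are disjoint, so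
      the conditional bounds \<open>\<delta> / 2\<close> are averaged and the number of sets
      \<open>J\<close> does not enter.\<close>
    define \<S> where "\<S> = {J. J \<subseteq> I \<and> m - s < card J \<and> card J < m + s}"
    have fin\<S>: "finite \<S>" unfolding \<S>_def by (rule finite_subset[of _ "Pow I"]) (use I in auto)
    have E: "E J \<in> events" if "J \<subseteq> I" for J
    proof -
      have "E J = {\<omega>\<in>space M. \<forall>i\<in>I. X i \<omega> \<in> T \<longleftrightarrow> i \<in> J}" using that by (auto simp: E_def)
      moreover have "{\<omega>\<in>space M. X i \<omega> \<in> T \<longleftrightarrow> i \<in> J} \<in> events" if "i \<in> I" for i
      proof -
        have "{\<omega>\<in>space M. X i \<omega> \<in> T} \<in> events"
          using measurable_sets[OF rv[OF that] T(1)] by (simp add: vimage_def Int_def conj_commute)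
        then show ?thesis using sets.sets_Collect_neg by (cases "i \<in> J") auto
      qed
      then have "{\<omega>\<in>space M. \<forall>i\<in>I. X i \<omega> \<in> T \<longleftrightarrow> i \<in> J} \<in> events"
        using I(1) by (rule sets.sets_Collect_finite_All)
      ultimately show ?thesis by simp
    qed
    have F: "F J \<in> sets (PiM J (\<lambda>_. Q))" if "J \<subseteq> I" for J
    proof -
      have [measurable]: "(\<lambda>x. real (hits J (A j) x)) \<in> borel_measurable (PiM J (\<lambda>_. Q))" for j
        using that I A finite_subset setsQ by (intro borel_measurable_hits_PiM) auto
      show ?thesis unfolding F_def by measurable
    qed
    have W: "W J \<in> events" if "J \<subseteq> I" for J
    proof -
      have x: "(\<lambda>\<omega>. restrict (\<lambda>i. X i \<omega>) J) \<in> measurable M (PiM J (\<lambda>_. Q))"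
        using rv that setsQ by (intro measurable_restrict) (auto cong: measurable_cong_sets)
      have "W J = E J \<inter> ((\<lambda>\<omega>. restrict (\<lambda>i. X i \<omega>) J) -` F J \<inter> space M)"
        by (auto simp: W_def E_def)
      then show ?thesis using E[OF that] measurable_sets[OF x F[OF that]] by auto
    qed
    have WJ: "prob (W J) \<le> prob (E J) * (\<delta> / 2)" if J: "J \<in> \<S>" for J
    proof -
      have JI: "J \<subseteq> I" using J by (simp add: \<S>_def)
      have finJ: "finite J" using JI I finite_subset by blast
      have "measure (PiM J (\<lambda>_. Q)) (F J) \<le> \<delta> / 2"
      \<comment> \<open>Devroye's inequality is available for relative deviations up to 1, that is,
        in the first case; with fewer points a deviation of this size is impossible.\<close>
      proof (cases "9 / 5 * R \<le> card J")
        case True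
        have cJ: "card J < m + s" using J by (simp add: \<S>_def)
        note D = Dev[OF cJ True]
        let ?e = "9 / 5 * R / card J"
        have ce: "card J * ?e = 9 / 5 * R" using D(1) by simp
        have "measure (PiM J (\<lambda>_. Q))
            {x\<in>space (PiM J (\<lambda>_. Q)). \<exists>j. card J * ?e < \<bar>hits J (A j) x - card J * Q.prob (A j)\<bar>}
          \<le> 4 * (3 * real (card J) ^ (2 * d) + 1) * exp 8 * exp (- (2 * real (card J) * ?e\<^sup>2))"
        proof (rule Devroye_inequality_growth[OF Q _ finJ refl D(1) _ _ growth])
          show "A j \<in> sets Q" for j using A setsQ by simp
          show "1 < card J * ?e" unfolding ce using B(4) by linarith
          show "?e \<le> 1" using True D(1) by (simp add: divide_le_eq)
        qed
        then show ?thesis using D(2) unfolding ce F_def by linarith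
      next
        case False
        have "\<not> 9 / 5 * R < \<bar>hits J (A j) x - card J * Q.prob (A j)\<bar>" for j x
          using hits_deviation_le[OF Q finJ refl, of "A j" x] False by linarith
        then have "F J = {}" by (simp add: F_def)
        then show ?thesis using \<delta> by simp
      qed
      moreover have "prob (W J) = prob (E J) * measure (PiM J (\<lambda>_. Q)) (F J)"
        unfolding W_def E_def Q_def
        by (rule prob_conditional_sample[OF P ind law I(1) JI T]) (use F[OF JI] in \<open>simp_all add: Q_def\<close>)
      ultimately show ?thesis by (simp only:) (intro mult_left_mono measure_nonneg)
    qed
    have sumE: "(\<Sum>J\<in>\<S>. prob (E J)) \<le> 1"
    proof -
      have "(\<Sum>J\<in>\<S>. prob (E J)) = prob (\<Union>J\<in>\<S>. E J)"
        using fin\<S> E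
        by (intro finite_measure_finite_Union[symmetric]) (auto simp: \<S>_def E_def disjoint_family_on_def)
      then show ?thesis by simp
    qed
    have "Bad \<subseteq> U1 \<union> U2 \<union> (\<Union>J\<in>\<S>. W J)"
    proof
      fix \<omega> assume "\<omega> \<in> Bad"
      then obtain j where w: "\<omega> \<in> space M"
        and j: "3 * R + 2 / 3 * l < \<bar>hits I (A j) (\<lambda>i. X i \<omega>) - n * P.prob (A j)\<bar>"
        by (auto simp: Bad_def)
      define J where "J = {i\<in>I. X i \<omega> \<in> T}"
      have cJ: "card J = K \<omega>" by (simp add: K_def J_def hits_def)
      show "\<omega> \<in> U1 \<union> U2 \<union> (\<Union>J\<in>\<S>. W J)"
      proof (cases "\<omega> \<in> U1 \<union> U2")
        case False
        then have dev: "m - s < card J" "card J < m + s" using w cJ by (auto simp: U1_def U2_def)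
        have J\<S>: "J \<in> \<S>" using dev by (auto simp: \<S>_def J_def)
        define h where "h = real (hits I (A j) (\<lambda>i. X i \<omega>))"
        define a where "a = Q.prob (A j)"
        have a: "0 \<le> a" "a \<le> 1" by (auto simp: a_def)
        have "hits J (A j) (restrict (\<lambda>i. X i \<omega>) J) = hits J (A j) (\<lambda>i. X i \<omega>)"
          by (rule hits_cong) simp
        also have "\<dots> = hits I (A j) (\<lambda>i. X i \<omega>)"
          unfolding hits_def J_def using A(2)[of j] by (intro arg_cong[where f = card]) auto
        finally have hJ: "real (hits J (A j) (restrict (\<lambda>i. X i \<omega>) J)) = h" by (simp add: h_def)
        have "n * P.prob (A j) = m * a" using q by (simp add: a_def QA m_eq I)
        then have j': "3 * R + 2 / 3 * l < \<bar>h - m * a\<bar>" using j by (simp add: h_def)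
        \<comment> \<open>Moving the centre from \<open>m * a\<close> to \<open>card J * a\<close>
          costs at most \<open>s\<close>, after which \<open>9 / 5 * R\<close> of the deviation is
          left for the conditional sample.\<close>
        have "\<bar>(card J - m) * a\<bar> \<le> \<bar>card J - m\<bar>"
          using a by (simp add: abs_mult mult_left_le)
        also have "\<dots> \<le> s" using dev by linarith
        finally have "\<bar>card J * a - m * a\<bar> \<le> s" by (simp add: left_diff_distrib)
        then have "9 / 5 * R < \<bar>h - card J * a\<bar>" using j' S(2) by linarith
        moreover have "restrict (\<lambda>i. X i \<omega>) J \<in> space (PiM J (\<lambda>_. Q))"
          using measurable_space[OF rv w] sets_eq_imp_space_eq[OF setsQ] by (auto simp: space_PiM J_def)
        ultimately have "restrict (\<lambda>i. X i \<omega>) J \<in> F J" unfolding F_def using hJ by (auto simp: a_def)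
        then have "\<omega> \<in> W J" using w by (simp add: W_def J_def)
        then show ?thesis using J\<S> by blast
      qed simp
    qed
    moreover have WU: "(\<Union>J\<in>\<S>. W J) \<in> events"
      using fin\<S> W by (intro sets.finite_UN) (auto simp: \<S>_def)
    ultimately have "prob Bad \<le> prob (U1 \<union> U2 \<union> (\<Union>J\<in>\<S>. W J))"
      using U by (intro finite_measure_mono) auto
    also have "\<dots> \<le> prob (U1 \<union> U2) + prob (\<Union>J\<in>\<S>. W J)"
      using U WU by (intro measure_Un_le) auto
    also have "prob (U1 \<union> U2) \<le> prob U1 + prob U2" using U by (rule measure_Un_le)
    also have "prob (\<Union>J\<in>\<S>. W J) \<le> (\<Sum>J\<in>\<S>. prob (W J))"
      using fin\<S> W by (intro measure_UNION_le) (auto simp: \<S>_def)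
    also have "\<dots> \<le> (\<Sum>J\<in>\<S>. prob (E J) * (\<delta> / 2))" by (rule sum_mono[OF WJ])
    also have "\<dots> = (\<Sum>J\<in>\<S>. prob (E J)) * (\<delta> / 2)" by (simp only: sum_distrib_right)
    also have "\<dots> \<le> 1 * (\<delta> / 2)" using sumE \<delta> by (intro mult_right_mono) auto
    finally show ?thesis using U1 U2 by linarith
  qed
  then show ?thesis by (simp only: Bad_def R_def L_def l_def)
qed

section \<open>Polar depth\<close>

text \<open>The set measured by the polar depth, with the radius detached from the point so that
  radius and direction can be perturbed and made countable independently.\<close>

definition cap :: "real \<Rightarrow> real^'d \<Rightarrow> (real^'d) set" where
  "cap r u = {y. r \<le> norm y \<and> 0 \<le> y \<bullet> u}"

lemma closed_cap:
  fixes u :: "real^'d"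
  shows "closed (cap r u)"
proof -
  have "closed {y :: real^'d. r \<le> norm y}" by (intro closed_Collect_le continuous_intros)
  moreover have "closed {y :: real^'d. 0 \<le> y \<bullet> u}" by (intro closed_Collect_le continuous_intros)
  ultimately show ?thesis unfolding cap_def by (rule closed_Collect_conj)
qed

lemma borel_cap [measurable]: "cap r u \<in> sets borel"
  using closed_cap by (rule borel_closed)

lemma cap_antimono: "r \<le> r' \<Longrightarrow> cap r' u \<subseteq> cap r u"
  by (auto simp: cap_def)

lemma polar_depth_eq_INF_cap:
  "polar_depth P x = (INF u\<in>{u \<in> sphere 0 1. 0 \<le> x \<bullet> u}. measure P (cap (norm x) u))"
  unfolding polar_depth_def cap_def halfspace0_def by simp

lemma directions_nonempty:
  fixes x :: "real^'d"
  assumes "x \<noteq> 0"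
  shows "{u \<in> sphere 0 1. 0 \<le> x \<bullet> u} \<noteq> {}"
proof -
  have "sgn x \<in> {u \<in> sphere 0 1. 0 \<le> x \<bullet> u}"
    using assms by (simp add: norm_sgn sgn_div_norm)
  then show ?thesis by blast
qed

text \<open>As a function of the radius and the direction the measure of a cap is upper semicontinuous,
  because nearby caps lie in a closed set slightly larger than the given one.\<close>

lemma measure_cap_usc:
  fixes u :: "real^'d"
  assumes "finite_measure \<mu>" "sets \<mu> = sets borel" "measure \<mu> (cap r u) < c"
  obtains \<epsilon> where "\<epsilon> > 0"
    "\<And>r' u'. \<bar>r' - r\<bar> < \<epsilon> \<Longrightarrow> norm (u' - u) < \<epsilon> \<Longrightarrow> measure \<mu> (cap r' u') < c"
proof -
  interpret finite_measure \<mu> by (rule assms(1))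
  \<comment> \<open>The slack in the direction grows with \<open>norm y\<close>, as the
    Cauchy-Schwarz bound on \<open>y \<bullet> (u' - u)\<close> does; a constant slack would not
    cover points far out.\<close>
  define C where "C k = {y :: real^'d. r - 1 / Suc k \<le> norm y \<and> - (norm y / Suc k) \<le> y \<bullet> u}" for k :: nat
  have C_closed: "closed (C k)" for k
  proof -
    have "closed {y :: real^'d. r - 1 / Suc k \<le> norm y}" by (intro closed_Collect_le continuous_intros)
    moreover have "closed {y :: real^'d. - (norm y / Suc k) \<le> y \<bullet> u}"
      by (intro closed_Collect_le continuous_intros) auto
    ultimately show ?thesis unfolding C_def by (rule closed_Collect_conj)
  qed
  have Cs: "C k \<in> sets \<mu>" for k using borel_closed[OF C_closed] assms(2) by simp
  have "decseq C"
  proof (rule decseq_SucI)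
    fix k
    have "1 / real (Suc (Suc k)) \<le> 1 / real (Suc k)" by (simp add: frac_le)
    moreover have "norm y / real (Suc (Suc k)) \<le> norm y / real (Suc k)" for y :: "real^'d"
      by (intro divide_left_mono) auto
    ultimately show "C (Suc k) \<subseteq> C k" unfolding C_def by (smt (verit) Collect_mono)
  qed
  then have "(\<lambda>k. measure \<mu> (C k)) \<longlonglongrightarrow> measure \<mu> (\<Inter>k. C k)"
    using Cs by (intro finite_Lim_measure_decseq) auto
  moreover have "(\<Inter>k. C k) = cap r u"
  proof (intro equalityI subsetI)
    fix y assume y: "y \<in> (\<Inter>k. C k)"
    have lim: "(\<lambda>k. 1 / real (Suc k)) \<longlonglongrightarrow> 0" by (rule lim_1_over_n[THEN LIMSEQ_Suc])
    have "(\<lambda>k. r - 1 / real (Suc k)) \<longlonglongrightarrow> r - 0" by (intro tendsto_intros lim)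
    then have "r - 0 \<le> norm y" using y by (intro LIMSEQ_le_const2) (auto simp: C_def)
    moreover have "(\<lambda>k. - (norm y * (1 / real (Suc k)))) \<longlonglongrightarrow> - (norm y * 0)" by (intro tendsto_intros lim)
    then have "- (norm y * 0) \<le> y \<bullet> u" using y by (intro LIMSEQ_le_const2) (auto simp: C_def)
    ultimately show "y \<in> cap r u" by (simp add: cap_def)
  next
    fix y assume y: "y \<in> cap r u"
    have "r - 1 / real (Suc k) \<le> r" "- (norm y / real (Suc k)) \<le> 0" for k by auto
    then show "y \<in> (\<Inter>k. C k)" using y unfolding C_def cap_def by (smt (verit) INT_I mem_Collect_eq)
  qed
  ultimately have "\<forall>\<^sub>F k in sequentially. measure \<mu> (C k) < c" using assms(3) by (simp add: order_tendstoD)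
  then obtain k where k: "measure \<mu> (C k) < c" by (auto simp: eventually_sequentially)
  show ?thesis
  proof (rule that[of "1 / Suc k"])
    fix r' u' assume r': "\<bar>r' - r\<bar> < 1 / Suc k" and u': "norm (u' - u) < 1 / Suc k"
    have "cap r' u' \<subseteq> C k"
    proof
      fix y assume y: "y \<in> cap r' u'"
      have "\<bar>y \<bullet> (u' - u)\<bar> \<le> norm y * norm (u' - u)" by (rule Cauchy_Schwarz_ineq2)
      also have "\<dots> \<le> norm y * (1 / Suc k)" using u' by (intro mult_left_mono) auto
      finally show "y \<in> C k" using y r' by (auto simp: cap_def C_def inner_diff_right abs_le_iff abs_less_iff)
    qed
    then have "measure \<mu> (cap r' u') \<le> measure \<mu> (C k)" using Cs by (intro finite_measure_mono)
    then show "measure \<mu> (cap r' u') < c" using k by simp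
  qed simp
qed

text \<open>Tilting an admissible direction slightly towards \<open>x\<close> makes the inner
  product positive, and by upper semicontinuity the measure of the cap stays below \<open>v\<close>.
  The strict form is open in \<open>x\<close> and in \<open>u\<close>, which both the measurability
  argument and the passage to a dense set of directions require.\<close>

lemma polar_depth_less_iff:
  fixes x :: "real^'d"
  assumes "finite_measure \<mu>" "sets \<mu> = sets borel" "x \<noteq> 0"
  shows "polar_depth \<mu> x < v \<longleftrightarrow> (\<exists>u\<in>sphere 0 1. 0 < x \<bullet> u \<and> measure \<mu> (cap (norm x) u) < v)"
proof -
  let ?D = "{u \<in> sphere 0 1. 0 \<le> x \<bullet> u}"
  have "bdd_below ((\<lambda>u. measure \<mu> (cap (norm x) u)) ` ?D)" by (intro bdd_belowI[of _ 0]) auto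
  then have iff: "polar_depth \<mu> x < v \<longleftrightarrow> (\<exists>u\<in>?D. measure \<mu> (cap (norm x) u) < v)"
    unfolding polar_depth_eq_INF_cap using directions_nonempty[OF assms(3)] by (intro cINF_less_iff)
  have "\<exists>u'\<in>sphere 0 1. 0 < x \<bullet> u' \<and> measure \<mu> (cap (norm x) u') < v"
    if u: "u \<in> ?D" "measure \<mu> (cap (norm x) u) < v" for u
  proof -
    obtain \<epsilon> where \<epsilon>: "\<epsilon> > 0"
      "\<And>r' u'. \<bar>r' - norm x\<bar> < \<epsilon> \<Longrightarrow> norm (u' - u) < \<epsilon> \<Longrightarrow> measure \<mu> (cap r' u') < v"
      using measure_cap_usc[OF assms(1,2) u(2)] by metis
    have u1: "norm u = 1" using u(1) by simp
    have "((\<lambda>s. sgn (u + s *\<^sub>R x)) \<longlongrightarrow> sgn (u + 0 *\<^sub>R x)) (at_right 0)"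
      using u1 by (intro tendsto_intros) auto
    then have "((\<lambda>s. sgn (u + s *\<^sub>R x)) \<longlongrightarrow> u) (at_right 0)" using u1 by (simp add: sgn_div_norm)
    then have "\<forall>\<^sub>F s in at_right 0. dist (sgn (u + s *\<^sub>R x)) u < \<epsilon>" using \<epsilon>(1) by (rule tendstoD)
    moreover have "\<forall>\<^sub>F s in at_right (0 :: real). s > 0" by (rule eventually_at_right_less)
    ultimately have "\<forall>\<^sub>F s in at_right 0. dist (sgn (u + s *\<^sub>R x)) u < \<epsilon> \<and> s > 0" by eventually_elim simp
    then obtain s where s: "dist (sgn (u + s *\<^sub>R x)) u < \<epsilon>" "s > 0"
      using eventually_happens[of _ "at_right (0 :: real)"] by auto
    define w where "w = u + s *\<^sub>R x"
    have "x \<bullet> w = x \<bullet> u + s * (x \<bullet> x)" by (simp add: w_def inner_add_right)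
    moreover have "s * (x \<bullet> x) > 0" using s assms(3) by simp
    moreover have "x \<bullet> u \<ge> 0" using u(1) by simp
    ultimately have xw: "x \<bullet> w > 0" by linarith
    then have "w \<noteq> 0" by auto
    then have "sgn w \<in> sphere 0 1" "0 < x \<bullet> sgn w" using xw by (simp_all add: norm_sgn sgn_div_norm)
    moreover have "measure \<mu> (cap (norm x) (sgn w)) < v"
      using \<epsilon>(1) s(1) by (intro \<epsilon>(2)) (simp_all add: w_def dist_norm)
    ultimately show ?thesis by blast
  qed
  then show ?thesis unfolding iff by fastforce
qed

lemma polar_depth_bounds:
  fixes x :: "real^'d"
  assumes "prob_space \<mu>" "x \<noteq> 0"
  shows "0 \<le> polar_depth \<mu> x" "polar_depth \<mu> x \<le> 1"
proof -
  interpret prob_space \<mu> by (rule assms(1))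
  obtain u where u: "u \<in> {u \<in> sphere 0 1. 0 \<le> x \<bullet> u}" using directions_nonempty[OF assms(2)] by blast
  show "0 \<le> polar_depth \<mu> x"
    unfolding polar_depth_eq_INF_cap by (rule cINF_greatest[OF directions_nonempty[OF assms(2)]]) simp
  have "polar_depth \<mu> x \<le> measure \<mu> (cap (norm x) u)"
    unfolding polar_depth_eq_INF_cap by (rule cINF_lower[OF bdd_belowI[of _ 0] u]) auto
  then show "polar_depth \<mu> x \<le> 1" using prob_le_1 order.trans by blast
qed

section \<open>Measurability of the uniform deviation event\<close>

lemma open_polar_depth_less:
  fixes P :: "(real^'d) measure"
  assumes "finite_measure P" "sets P = sets borel"
  shows "open {x. x \<noteq> 0 \<and> polar_depth P x < v}"
proof -
  have "open {x :: real^'d. 0 < x \<bullet> u \<and> measure P (cap (norm x) u) < v}" for u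
  proof (rule openI)
    fix x :: "real^'d" assume "x \<in> {x. 0 < x \<bullet> u \<and> measure P (cap (norm x) u) < v}"
    then have x: "0 < x \<bullet> u" "measure P (cap (norm x) u) < v" by auto
    obtain \<epsilon> where \<epsilon>: "\<epsilon> > 0"
      "\<And>r' u'. \<bar>r' - norm x\<bar> < \<epsilon> \<Longrightarrow> norm (u' - u) < \<epsilon> \<Longrightarrow> measure P (cap r' u') < v"
      using measure_cap_usc[OF assms x(2)] by metis
    have "open {x :: real^'d. 0 < x \<bullet> u}" by (intro open_Collect_less continuous_intros)
    then obtain e where e: "e > 0" "ball x e \<subseteq> {x. 0 < x \<bullet> u}"
      using x(1) open_contains_ball by (metis (mono_tags, lifting) mem_Collect_eq)
    have "ball x (min e \<epsilon>) \<subseteq> {x. 0 < x \<bullet> u \<and> measure P (cap (norm x) u) < v}"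
    proof
      fix z assume z: "z \<in> ball x (min e \<epsilon>)"
      have "\<bar>norm z - norm x\<bar> \<le> norm (z - x)" by (rule norm_triangle_ineq3)
      also have "\<dots> < \<epsilon>" using z by (simp add: dist_norm norm_minus_commute)
      finally show "z \<in> {x. 0 < x \<bullet> u \<and> measure P (cap (norm x) u) < v}"
        using z e \<epsilon> by auto
    qed
    then show "\<exists>d>0. ball x d \<subseteq> {x. 0 < x \<bullet> u \<and> measure P (cap (norm x) u) < v}"
      using e \<epsilon> by (intro exI[of _ "min e \<epsilon>"]) auto
  qed
  then have "open (\<Union>u\<in>sphere 0 1. {x :: real^'d. 0 < x \<bullet> u \<and> measure P (cap (norm x) u) < v})" by blast
  moreover have "{x. x \<noteq> 0 \<and> polar_depth P x < v}
      = (\<Union>u\<in>sphere 0 1. {x. 0 < x \<bullet> u \<and> measure P (cap (norm x) u) < v})"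
  proof (rule set_eqI)
    fix x
    show "x \<in> {x. x \<noteq> 0 \<and> polar_depth P x < v}
        \<longleftrightarrow> x \<in> (\<Union>u\<in>sphere 0 1. {x. 0 < x \<bullet> u \<and> measure P (cap (norm x) u) < v})"
      by (cases "x = 0") (auto simp: polar_depth_less_iff[OF assms])
  qed
  ultimately show ?thesis by simp
qed

lemma measure_empirical_eq_hits:
  "n \<ge> 1 \<Longrightarrow> A \<in> sets borel \<Longrightarrow> measure (empirical_measure n y) A = hits {1..n} A y / n"
  by (simp add: measure_empirical_measure hits_def)

lemma prob_space_empirical_measure:
  fixes y :: "nat \<Rightarrow> 'a::topological_space"
  assumes "n \<ge> 1"
  shows "prob_space (empirical_measure n y)"
proof
  have "emeasure (empirical_measure n y) UNIV = (1 / of_nat n) * of_nat n"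
    by (subst emeasure_empirical_measure) auto
  also have "\<dots> = 1"
    using assms by (simp add: ennreal_of_nat_eq_real_of_nat divide_ennreal flip: ennreal_1 ennreal_mult)
  finally show "emeasure (empirical_measure n y) (space (empirical_measure n y)) = 1" by simp
qed

text \<open>The empirical measure of a cap is below \<open>v\<close> iff, for some \<open>J\<close>
  with fewer than \<open>n * v\<close> indices, all points outside \<open>J\<close> miss the closed
  cap. Missing it is expressed by strict inequalities, hence an open condition on sample and point
  jointly.\<close>

lemma open_empirical_polar_depth_less:
  fixes n :: nat and v :: real
  assumes n: "n \<ge> 1"
  shows "open {(y, x). x \<noteq> (0 :: real^'d) \<and> polar_depth (empirical_measure n y) x < v}"
proof -
  define W where "W i u = {z :: (nat \<Rightarrow> real^'d) \<times> (real^'d). norm (fst z i) < norm (snd z) \<or> fst z i \<bullet> u < 0}" for i u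
  have coord: "continuous_on S (\<lambda>z :: (nat \<Rightarrow> real^'d) \<times> (real^'d). fst z i)" for S i
    by (rule continuous_on_compose2[OF continuous_on_product_coordinates[of i] continuous_on_fst]) auto
  have W: "open (W i u)" for i u
  proof -
    have "open {z :: (nat \<Rightarrow> real^'d) \<times> (real^'d). norm (fst z i) < norm (snd z)}"
      by (intro open_Collect_less continuous_intros coord)
    moreover have "open {z :: (nat \<Rightarrow> real^'d) \<times> (real^'d). fst z i \<bullet> u < 0}"
      by (intro open_Collect_less continuous_intros coord)
    ultimately show ?thesis unfolding W_def by (rule open_Collect_disj)
  qed
  define \<J> where "\<J> = {J. J \<subseteq> {1..n} \<and> card J < n * v}"
  define H where "H u = {z :: (nat \<Rightarrow> real^'d) \<times> (real^'d). 0 < snd z \<bullet> u}" for u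
  have H: "open (H u)" for u unfolding H_def by (intro open_Collect_less continuous_intros)
  have "{(y, x). x \<noteq> (0 :: real^'d) \<and> polar_depth (empirical_measure n y) x < v}
      = (\<Union>u\<in>sphere 0 1. H u \<inter> (\<Union>J\<in>\<J>. \<Inter>i\<in>{1..n} - J. W i u))"
  proof (rule set_eqI)
    fix z :: "(nat \<Rightarrow> real^'d) \<times> (real^'d)"
    obtain y x where z: "z = (y, x)" by (cases z)
    have key: "measure (empirical_measure n y) (cap (norm x) u) < v
        \<longleftrightarrow> (\<exists>J\<in>\<J>. \<forall>i\<in>{1..n} - J. (y, x) \<in> W i u)" for u
    proof -
      define C where "C = {i\<in>{1..n}. y i \<in> cap (norm x) u}"
      have mem: "(y, x) \<in> W i u \<longleftrightarrow> y i \<notin> cap (norm x) u" for i by (auto simp: W_def cap_def)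
      have "measure (empirical_measure n y) (cap (norm x) u) < v \<longleftrightarrow> card C < n * v"
        using n by (simp add: measure_empirical_eq_hits hits_def C_def pos_divide_less_eq mult.commute)
      also have "\<dots> \<longleftrightarrow> (\<exists>J\<in>\<J>. C \<subseteq> J)"
      proof
        assume "\<exists>J\<in>\<J>. C \<subseteq> J"
        then obtain J where J: "C \<subseteq> J" "J \<subseteq> {1..n}" "card J < n * v" by (auto simp: \<J>_def)
        then have "card C \<le> card J" by (intro card_mono finite_subset[OF J(2)]) auto
        then show "card C < n * v" using J(3) by linarith
      next
        assume "card C < n * v"
        then have "C \<in> \<J>" by (auto simp: \<J>_def C_def)
        then show "\<exists>J\<in>\<J>. C \<subseteq> J" by blast
      qed
      also have "\<dots> \<longleftrightarrow> (\<exists>J\<in>\<J>. \<forall>i\<in>{1..n} - J. (y, x) \<in> W i u)"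
        unfolding mem C_def by blast
      finally show ?thesis .
    qed
    show "z \<in> {(y, x). x \<noteq> 0 \<and> polar_depth (empirical_measure n y) x < v}
      \<longleftrightarrow> z \<in> (\<Union>u\<in>sphere 0 1. H u \<inter> (\<Union>J\<in>\<J>. \<Inter>i\<in>{1..n} - J. W i u))"
    proof (cases "x = 0")
      case False
      interpret prob_space "empirical_measure n y" by (rule prob_space_empirical_measure[OF n])
      have "(y, x) \<in> {(y, x). x \<noteq> 0 \<and> polar_depth (empirical_measure n y) x < v} \<longleftrightarrow>
        (\<exists>u\<in>sphere 0 1. 0 < x \<bullet> u \<and> measure (empirical_measure n y) (cap (norm x) u) < v)"
        using polar_depth_less_iff[OF finite_measure_axioms sets_empirical_measure False] False by simp
      then show ?thesis unfolding key z by (simp add: H_def)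
    qed (simp add: H_def z)
  qed
  moreover have "open (\<Inter>i\<in>{1..n} - J. W i u)" for J u using W by (intro open_INT) auto
  then have "open (\<Union>u\<in>sphere 0 1. H u \<inter> (\<Union>J\<in>\<J>. \<Inter>i\<in>{1..n} - J. W i u))"
    using H by (intro open_UN open_Int ballI)
  ultimately show ?thesis by simp
qed

text \<open>The samples whose empirical depth is too small at some point form an open set. Those whose
  empirical depth is too large form a countable union of closed sets, by the tube lemma, because the
  sublevel sets of the depth are \<open>\<sigma>\<close>-compact.\<close>

lemma borel_uniform_polar_depth_deviation_le:
  fixes P :: "(real^'d) measure" and S :: "(real^'d) set"
  assumes n: "n \<ge> 1" and P: "finite_measure P" "sets P = sets borel" and S: "closed S"
  shows "{y :: nat \<Rightarrow> real^'d. \<forall>x\<in>S - {0}. \<bar>polar_depth (empirical_measure n y) x - polar_depth P x\<bar> \<le> c}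
    \<in> sets borel"
proof -
  let ?F = "\<lambda>y x. polar_depth (empirical_measure n y) x" and ?G = "polar_depth P"
  define W where "W v = {(y :: nat \<Rightarrow> real^'d, x). x \<noteq> 0 \<and> ?F y x < v}" for v
  have W: "open (W v)" for v unfolding W_def by (rule open_empirical_polar_depth_less[OF n])
  define B1 where "B1 = (\<Union>x\<in>S - {0}. {y. ?F y x < ?G x - c})"
  have "open B1" unfolding B1_def
  proof (intro open_UN ballI)
    fix x assume x: "x \<in> S - {0}"
    have "open ((\<lambda>y. (y, x)) -` W (?G x - c))" by (intro open_vimage W continuous_intros)
    then show "open {y. ?F y x < ?G x - c}" using x by (simp add: W_def vimage_def)
  qed
  have "\<exists>C. (\<forall>k :: nat. compact (C k)) \<and> (\<Union>k. C k) = {x. x \<noteq> 0 \<and> ?G x < q}" for q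
    by (rule open_Union_compact_subsets[OF open_polar_depth_less[OF P, of q]]) blast
  then obtain C where C: "\<And>q k :: nat. compact (C q k)" "\<And>q. (\<Union>k. C q k) = {x. x \<noteq> 0 \<and> ?G x < q}"
    by metis
  \<comment> \<open>An excess of the empirical depth over \<open>?G x + c\<close> is witnessed by a
    rational \<open>q\<close> with \<open>?G x < q\<close> and \<open>q + c \<le> ?F y x\<close>,
    which keeps the union countable.\<close>
  define B2 where "B2 = (\<Union>q\<in>\<rat>. \<Union>k. {y. \<not> (\<forall>x\<in>C q k \<inter> S. ?F y x < q + c)})"
  have "{y. \<not> (\<forall>x\<in>C q k \<inter> S. ?F y x < q + c)} \<in> sets borel" for q k
  proof -
    have C0: "C q k \<subseteq> {x. x \<noteq> 0 \<and> ?G x < q}" using C(2)[of q] by blast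
    have iff: "(\<forall>x\<in>C q k \<inter> S. ?F y x < q + c) \<longleftrightarrow> {y} \<times> (C q k \<inter> S) \<subseteq> W (q + c)" for y
      using C0 by (auto simp: W_def)
    have "open {y. {y} \<times> (C q k \<inter> S) \<subseteq> W (q + c)}"
    proof (subst open_subopen, rule ballI)
      fix y assume "y \<in> {y. {y} \<times> (C q k \<inter> S) \<subseteq> W (q + c)}"
      then have "{y} \<times> (C q k \<inter> S) \<subseteq> W (q + c)" by simp
      from Elementary_Topology.tube_lemma[OF compact_Int_closed[OF C(1) S] W this]
      obtain X0 where "y \<in> X0" "open X0" "X0 \<times> (C q k \<inter> S) \<subseteq> W (q + c)" by blast
      then show "\<exists>T. open T \<and> y \<in> T \<and> T \<subseteq> {y. {y} \<times> (C q k \<inter> S) \<subseteq> W (q + c)}" by blast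
    qed
    then have "closed (- {y. {y} \<times> (C q k \<inter> S) \<subseteq> W (q + c)})" by (rule closed_Compl)
    then have "- {y. {y} \<times> (C q k \<inter> S) \<subseteq> W (q + c)} \<in> sets borel" by (rule borel_closed)
    then show ?thesis unfolding iff by (simp add: Compl_eq)
  qed
  then have "B2 \<in> sets borel" unfolding B2_def by (intro sets.countable_UN'' countable_rat) auto
  moreover have "{y. \<forall>x\<in>S - {0}. \<bar>?F y x - ?G x\<bar> \<le> c} = UNIV - (B1 \<union> B2)"
  proof (rule set_eqI)
    fix y
    have "y \<in> B2 \<longleftrightarrow> (\<exists>x\<in>S - {0}. ?G x + c < ?F y x)"
    proof
      assume "y \<in> B2"
      then obtain q k x where x: "x \<in> C q k" "x \<in> S" "\<not> ?F y x < q + c" by (auto simp: B2_def)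
      then have "x \<noteq> 0" "?G x < q" using C(2)[of q] by blast+
      then show "\<exists>x\<in>S - {0}. ?G x + c < ?F y x" using x by (intro bexI[of _ x]) auto
    next
      assume "\<exists>x\<in>S - {0}. ?G x + c < ?F y x"
      then obtain x where x: "x \<in> S" "x \<noteq> 0" "?G x < ?F y x - c" by (auto simp: algebra_simps)
      then obtain q where q: "q \<in> \<rat>" "?G x < q" "q < ?F y x - c" using Rats_dense_in_real by blast
      then obtain k where "x \<in> C q k" using x C(2)[of q] by blast
      moreover have "\<not> ?F y x < q + c" using q by simp
      ultimately show "y \<in> B2" using q(1) x(1) unfolding B2_def by blast
    qed
    moreover have "y \<in> B1 \<longleftrightarrow> (\<exists>x\<in>S - {0}. ?F y x < ?G x - c)" by (auto simp: B1_def)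
    moreover have "\<bar>?F y x - ?G x\<bar> \<le> c \<longleftrightarrow> \<not> ?F y x < ?G x - c \<and> \<not> ?G x + c < ?F y x" for x by linarith
    ultimately show "y \<in> {y. \<forall>x\<in>S - {0}. \<bar>?F y x - ?G x\<bar> \<le> c} \<longleftrightarrow> y \<in> UNIV - (B1 \<union> B2)"
      by (simp only: mem_Collect_eq Diff_iff Un_iff UNIV_I simp_thms) blast
  qed
  ultimately show ?thesis using \<open>open B1\<close> by (auto intro: sets.Diff sets.Un)
qed

section \<open>Reduction of the depth to countably many caps\<close>

lemma polar_depth_le_if_caps_le:
  fixes x :: "real^'d"
  assumes \<mu>: "finite_measure \<mu>" "sets \<mu> = sets borel" and \<nu>: "finite_measure \<nu>" "sets \<nu> = sets borel"
    and D: "sphere 0 1 \<subseteq> closure D" "D \<subseteq> sphere 0 1"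
    and caps: "\<And>u. u \<in> D \<Longrightarrow> measure \<nu> (cap (norm x) u) \<le> measure \<mu> (cap (norm x) u) + c"
    and x: "x \<noteq> 0"
  shows "polar_depth \<nu> x \<le> polar_depth \<mu> x + c"
proof -
  have "polar_depth \<nu> x - c \<le> v" if v: "polar_depth \<mu> x < v" for v
  proof -
    obtain u where u: "u \<in> sphere 0 1" "0 < x \<bullet> u" "measure \<mu> (cap (norm x) u) < v"
      using polar_depth_less_iff[OF \<mu> x, THEN iffD1, OF v] by auto
    obtain \<epsilon> where \<epsilon>: "\<epsilon> > 0"
      "\<And>r' u'. \<bar>r' - norm x\<bar> < \<epsilon> \<Longrightarrow> norm (u' - u) < \<epsilon> \<Longrightarrow> measure \<mu> (cap r' u') < v"
      using measure_cap_usc[OF \<mu> u(3)] by metis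
    \<comment> \<open>The first entry keeps the measure of the nearby cap below \<open>v\<close>,
      the second keeps the inner product with \<open>x\<close> positive.\<close>
    define e where "e = min \<epsilon> (x \<bullet> u / norm x)"
    have e: "e > 0" using \<epsilon> u x by (simp add: e_def)
    obtain w where w: "w \<in> D" "dist w u < e"
      using D(1) u(1) e closure_approachable by blast
    have "\<bar>x \<bullet> (w - u)\<bar> \<le> norm x * norm (w - u)" by (rule Cauchy_Schwarz_ineq2)
    also have "\<dots> < norm x * (x \<bullet> u / norm x)"
      using w x by (intro mult_strict_left_mono) (auto simp: e_def dist_norm)
    also have "\<dots> = x \<bullet> u" using x by simp
    finally have "0 < x \<bullet> w" by (simp add: inner_diff_right abs_less_iff)
    moreover have "measure \<mu> (cap (norm x) w) < v" using w \<epsilon> by (intro \<epsilon>(2)) (auto simp: e_def dist_norm)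
    then have "measure \<nu> (cap (norm x) w) < v + c" using caps[OF w(1)] by linarith
    ultimately have "polar_depth \<nu> x < v + c" using polar_depth_less_iff[OF \<nu> x] w(1) D(2) by blast
    then show ?thesis by simp
  qed
  then have "polar_depth \<nu> x - c \<le> polar_depth \<mu> x" by (rule dense_ge)
  then show ?thesis by simp
qed

text \<open>Quantified over all pairs of finite measures, so that one deterministic family serves
  every realisation of the empirical measure.\<close>

definition controls_polar_depth :: "real \<Rightarrow> (nat \<Rightarrow> (real^'d) set) \<Rightarrow> bool" where
  "controls_polar_depth t A \<longleftrightarrow>
     (\<forall>\<mu> \<nu> c x. finite_measure \<mu> \<and> sets \<mu> = sets borel \<and> finite_measure \<nu> \<and> sets \<nu> = sets borel \<and>
        (\<forall>j. \<bar>measure \<mu> (A j) - measure \<nu> (A j)\<bar> \<le> c) \<and> x \<noteq> 0 \<and> t \<le> norm x \<longrightarrow>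
        \<bar>polar_depth \<mu> x - polar_depth \<nu> x\<bar> \<le> c)"

lemma countable_cap_family:
  fixes t :: real
  obtains A :: "nat \<Rightarrow> (real^'d) set" where
    "\<And>j. A j \<in> sets borel" "\<And>j. A j \<subseteq> {y. t \<le> norm y}" "growth_le CARD('d) A"
    "controls_polar_depth t A"
proof -
  obtain D :: "(real^'d) set" where D: "countable D" "D \<subseteq> sphere 0 1" "sphere 0 1 \<subseteq> closure D"
    using separable by metis
  have "sphere (0 :: real^'d) 1 \<noteq> {}" by simp
  then have "D \<noteq> {}" using D(3) by auto
  \<comment> \<open>A radius above \<open>t\<close> is approximated from below by rationals that
    stay above \<open>t\<close>, so these caps remain in the tail. No such approximation exists for
    the radius \<open>t\<close>, which is therefore adjoined.\<close>
  define \<R> where "\<R> = insert t (\<rat> \<inter> {t..})"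
  define Z where "Z = \<R> \<times> D"
  have Z: "countable Z" "Z \<noteq> {}"
    using D(1) \<open>D \<noteq> {}\<close> countable_rat by (auto simp: Z_def \<R>_def)
  define A where "A j = (case from_nat_into Z j of (r, u) \<Rightarrow> cap r u)" for j
  have A_ex: "\<exists>r u. t \<le> r \<and> A j = cap r u" for j
  proof -
    obtain r u where ru: "from_nat_into Z j = (r, u)" by fastforce
    then have "t \<le> r" using from_nat_into[OF Z(2), of j] by (auto simp: Z_def \<R>_def)
    moreover have "A j = cap r u" by (simp add: A_def ru)
    ultimately show ?thesis by blast
  qed
  have ex_A: "\<exists>j. A j = cap r u" if ru: "r \<in> \<R>" "u \<in> D" for r u
  proof -
    obtain j where "from_nat_into Z j = (r, u)"
      using from_nat_into_surj[OF Z(1), of "(r, u)"] ru by (auto simp: Z_def)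
    then show ?thesis by (intro exI[of _ j]) (simp add: A_def)
  qed
  show ?thesis
  proof (rule that)
    show "A j \<in> sets borel" for j using A_ex[of j] borel_cap by metis
    show "A j \<subseteq> {y. t \<le> norm y}" for j using A_ex[of j] by (auto simp: cap_def)
    show "growth_le CARD('d) A"
      unfolding growth_le_def
    proof (intro allI)
      fix N and y :: "nat \<Rightarrow> real^'d"
      let ?T = "(\<lambda>(r, u). {i\<in>{..<N}. r \<le> norm (y i) \<and> 0 \<le> y i \<bullet> u}) ` UNIV"
      have "range (\<lambda>j. {i\<in>{..<N}. y i \<in> A j}) \<subseteq> ?T"
      proof (rule image_subsetI)
        fix j
        obtain r u where "A j = cap r u" using A_ex by blast
        then show "{i\<in>{..<N}. y i \<in> A j} \<in> ?T" by (auto simp: cap_def intro!: image_eqI[of _ _ "(r, u)"])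
      qed
      moreover have "finite ?T" by (rule finite_subset[of _ "Pow {..<N}"]) auto
      ultimately have "card (range (\<lambda>j. {i\<in>{..<N}. y i \<in> A j})) \<le> card ?T" by (intro card_mono)
      also have "\<dots> \<le> 3 * card {..<N} ^ DIM(real^'d) + 1" by (rule card_polar_traces_le) simp
      finally show "card (range (\<lambda>j. {i\<in>{..<N}. y i \<in> A j})) \<le> 3 * N ^ CARD('d) + 1" by simp
    qed
    show "controls_polar_depth t A"
      unfolding controls_polar_depth_def
    proof (intro allI impI, elim conjE)
      fix \<mu> \<nu> :: "(real^'d) measure" and c :: real and x :: "real^'d"
      assume \<mu>: "finite_measure \<mu>" "sets \<mu> = sets borel" and \<nu>: "finite_measure \<nu>" "sets \<nu> = sets borel"
        and c: "\<forall>j. \<bar>measure \<mu> (A j) - measure \<nu> (A j)\<bar> \<le> c" and x: "x \<noteq> 0" "t \<le> norm x"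
      have caps: "measure \<nu>' (cap r u) \<le> measure \<mu>' (cap r u) + c"
        if \<mu>': "finite_measure \<mu>'" "sets \<mu>' = sets borel" and \<nu>': "finite_measure \<nu>'" "sets \<nu>' = sets borel"
          and c: "\<And>j. measure \<nu>' (A j) \<le> measure \<mu>' (A j) + c" and r: "t \<le> r" and u: "u \<in> D"
        for \<mu>' \<nu>' r u
      proof (cases "r = t")
        case True
        then obtain j where "A j = cap r u" using ex_A[of r u] u by (auto simp: \<R>_def)
        then show ?thesis using c[of j] by simp
      next
        case False
        have "measure \<nu>' (cap r u) - c \<le> v" if v: "measure \<mu>' (cap r u) < v" for v
        proof -
          obtain \<epsilon> where \<epsilon>: "\<epsilon> > 0"
            "\<And>r' u'. \<bar>r' - r\<bar> < \<epsilon> \<Longrightarrow> norm (u' - u) < \<epsilon> \<Longrightarrow> measure \<mu>' (cap r' u') < v"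
            using measure_cap_usc[OF \<mu>' v] by metis
          have "max t (r - \<epsilon>) < r" using False r \<epsilon>(1) by simp
          then obtain q where q: "q \<in> \<rat>" "max t (r - \<epsilon>) < q" "q < r" using Rats_dense_in_real by blast
          then have "q \<in> \<R>" by (simp add: \<R>_def)
          then obtain j where j: "A j = cap q u" using ex_A u by blast
          have "measure \<nu>' (cap r u) \<le> measure \<nu>' (cap q u)"
            using q \<nu>' cap_antimono[of q r u] borel_cap by (intro finite_measure.finite_measure_mono) auto
          moreover have "measure \<mu>' (cap q u) < v" using q \<epsilon> by (intro \<epsilon>(2)) auto
          ultimately show ?thesis using c[of j] unfolding j by linarith
        qed
        then have "measure \<nu>' (cap r u) - c \<le> measure \<mu>' (cap r u)" by (rule dense_ge)
        then show ?thesis by simp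
      qed
      have c1: "measure \<nu> (A j) \<le> measure \<mu> (A j) + c" and c2: "measure \<mu> (A j) \<le> measure \<nu> (A j) + c" for j
        using c[rule_format, of j] by linarith+
      have "polar_depth \<nu> x \<le> polar_depth \<mu> x + c"
        by (rule polar_depth_le_if_caps_le[OF \<mu> \<nu> D(3,2) caps[OF \<mu> \<nu> c1 x(2)] x(1)])
      moreover have "polar_depth \<mu> x \<le> polar_depth \<nu> x + c"
        by (rule polar_depth_le_if_caps_le[OF \<nu> \<mu> D(3,2) caps[OF \<nu> \<mu> c2 x(2)] x(1)])
      ultimately show "\<bar>polar_depth \<mu> x - polar_depth \<nu> x\<bar> \<le> c" by linarith
    qed
  qed
qed

lemma (in prob_space) sup_polar_depth_deviation:
  fixes P :: "(real^'d) measure" and S :: "(real^'d) set" and c t :: real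
  assumes P: "prob_space P" "sets P = sets borel" and n: "n \<ge> 1"
    and rv: "\<And>i. i \<in> {1..n} \<Longrightarrow> X i \<in> measurable M borel"
    and S: "closed S" "S - {0} \<noteq> {}" "\<And>x. x \<in> S \<Longrightarrow> t \<le> norm x"
    and A: "\<And>j :: nat. A j \<in> sets borel"
      "controls_polar_depth t A"
  shows "1 - prob {\<omega>\<in>space M. \<exists>j. n * c < \<bar>hits {1..n} (A j) (\<lambda>i. X i \<omega>) - n * measure P (A j)\<bar>}
    \<le> prob {\<omega>\<in>space M. (SUP x\<in>S - {0}.
        \<bar>polar_depth (empirical_measure n (\<lambda>i. X i \<omega>)) x - polar_depth P x\<bar>) \<le> c}"
proof -
  interpret P: prob_space P by (rule P)
  let ?F = "\<lambda>y x. polar_depth (empirical_measure n y) x"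
  define Bad where "Bad = {\<omega>\<in>space M. \<exists>j. n * c < \<bar>hits {1..n} (A j) (\<lambda>i. X i \<omega>) - n * measure P (A j)\<bar>}"
  define Good where "Good = {\<omega>\<in>space M. (SUP x\<in>S - {0}. \<bar>?F (\<lambda>i. X i \<omega>) x - polar_depth P x\<bar>) \<le> c}"
  have Good_eq: "Good = {\<omega>\<in>space M. \<forall>x\<in>S - {0}. \<bar>?F (\<lambda>i. X i \<omega>) x - polar_depth P x\<bar> \<le> c}"
  proof -
    have "(SUP x\<in>S - {0}. \<bar>?F y x - polar_depth P x\<bar>) \<le> c \<longleftrightarrow> (\<forall>x\<in>S - {0}. \<bar>?F y x - polar_depth P x\<bar> \<le> c)" for y
    proof (rule cSUP_le_iff[OF S(2)])
      show "bdd_above ((\<lambda>x. \<bar>?F y x - polar_depth P x\<bar>) ` (S - {0}))"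
      proof (rule bdd_aboveI2[of _ _ 1])
        fix x assume "x \<in> S - {0}"
        then have "x \<noteq> 0" by simp
        then show "\<bar>?F y x - polar_depth P x\<bar> \<le> 1"
          using polar_depth_bounds[OF P(1), of x] polar_depth_bounds[OF prob_space_empirical_measure[OF n, of y], of x]
          by linarith
      qed
    qed
    then show ?thesis by (simp only: Good_def)
  qed
  \<comment> \<open>Measurability of \<open>X i\<close> is known only for \<open>i\<close> in
    \<open>{1..n}\<close>. The remaining coordinates, which the empirical measure ignores, are set
    to 0 to obtain a measurable map into the full sequence space.\<close>
  define Y where "Y \<omega> i = (if i \<in> {1..n} then X i \<omega> else 0)" for \<omega> i
  have Y: "Y \<in> borel_measurable M"
  proof (rule measurable_coordinatewise_then_product)
    fix i
    show "(\<lambda>\<omega>. Y \<omega> i) \<in> borel_measurable M"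
    proof (cases "i \<in> {1..n}")
      case True
      then have "(\<lambda>\<omega>. Y \<omega> i) = X i" by (simp only: Y_def if_True)
      then show ?thesis using rv[OF True] by simp
    next
      case False
      then have "(\<lambda>\<omega>. Y \<omega> i) = (\<lambda>_. 0)" by (simp only: Y_def if_False)
      then show ?thesis by simp
    qed
  qed
  have meas_eq: "measure (empirical_measure n (Y \<omega>)) B = measure (empirical_measure n (\<lambda>i. X i \<omega>)) B"
    if "B \<in> sets borel" for \<omega> B
    using n that hits_cong[of "{1..n}" "Y \<omega>" "\<lambda>i. X i \<omega>" B] by (simp add: measure_empirical_eq_hits Y_def)
  have "?F (Y \<omega>) x = ?F (\<lambda>i. X i \<omega>) x" for \<omega> x
    unfolding polar_depth_eq_INF_cap by (simp add: meas_eq)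
  then have "Good = Y -` {y. \<forall>x\<in>S - {0}. \<bar>?F y x - polar_depth P x\<bar> \<le> c} \<inter> space M"
    unfolding Good_eq by auto
  then have Good: "Good \<in> events"
    using measurable_sets[OF Y borel_uniform_polar_depth_deviation_le[OF n P.finite_measure_axioms P(2) S(1)]]
    by simp
  have [measurable]: "(\<lambda>\<omega>. real (hits {1..n} (A j) (\<lambda>i. X i \<omega>))) \<in> borel_measurable M" for j
    using rv A(1) by (intro borel_measurable_hits) auto
  have Bad: "Bad \<in> events" unfolding Bad_def by measurable
  have "space M - Bad \<subseteq> Good"
  proof
    fix \<omega> assume w: "\<omega> \<in> space M - Bad"
    let ?\<mu> = "empirical_measure n (\<lambda>i. X i \<omega>)"
    interpret E: prob_space ?\<mu> by (rule prob_space_empirical_measure[OF n])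
    have "\<bar>measure ?\<mu> (A j) - measure P (A j)\<bar> \<le> c" for j
    proof -
      have "n * \<bar>measure ?\<mu> (A j) - measure P (A j)\<bar> = \<bar>n * (measure ?\<mu> (A j) - measure P (A j))\<bar>"
        by (simp add: abs_mult)
      also have "\<dots> = \<bar>hits {1..n} (A j) (\<lambda>i. X i \<omega>) - n * measure P (A j)\<bar>"
        using n A(1) by (simp add: measure_empirical_eq_hits right_diff_distrib)
      also have "\<dots> \<le> n * c" using w by (auto simp: Bad_def not_less)
      finally show ?thesis using n by simp
    qed
    then have "\<bar>?F (\<lambda>i. X i \<omega>) x - polar_depth P x\<bar> \<le> c" if "x \<in> S - {0}" for x
      using A(2) that S(3)[of x] E.finite_measure_axioms P.finite_measure_axioms P(2)
      unfolding controls_polar_depth_def by simp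
    then show "\<omega> \<in> Good" using w by (simp add: Good_eq)
  qed
  then have "prob (space M - Bad) \<le> prob Good" using Good by (rule finite_measure_mono)
  then show ?thesis using prob_compl[OF Bad] by (simp add: Good_def Bad_def)
qed

theorem theorem3p1:
  fixes P :: "(real^'d) measure"
    and M :: "'w measure"
    and X :: "nat \<Rightarrow> 'w \<Rightarrow> real^'d"
    and n :: nat
    and \<delta> :: real
  assumes "CARD('d) \<ge> 2"
    and "prob_space P" and "sets P = sets borel"
    and "prob_space M"
    and "n \<ge> 1"
    and "prob_space.indep_vars M (\<lambda>_. borel) X {1..n}"
    and "\<And>i. i \<in> {1..n} \<Longrightarrow> distr M borel (X i) = P"
    and "0 < \<delta>" and "\<delta> < 1"
  shows "(\<delta> ^ (2 * CARD('d) - 1) \<le> 1 / (17 * exp 8) \<and> n \<ge> 4 \<longrightarrow>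
      measure M {\<omega> \<in> space M.
        (SUP x\<in>UNIV - {0}. \<bar>polar_depth (empirical_measure n (\<lambda>i. X i \<omega>)) x - polar_depth P x\<bar>)
          \<le> sqrt (real CARD('d) * ln (real n / \<delta>) / real n)} > 1 - \<delta>)
    \<and> (\<forall>t p :: real. 0 < t \<and> p = measure P {y. norm y \<ge> t} \<and> 0 < p \<and> (2 * \<delta>) ^ CARD('d) \<le> 1 / 8 \<longrightarrow>
      measure M {\<omega> \<in> space M.
        (1 / p) *
        (SUP x\<in>{x. norm x \<ge> t}. \<bar>polar_depth (empirical_measure n (\<lambda>i. X i \<omega>)) x - polar_depth P x\<bar>)
          \<le> 3 * sqrt (real CARD('d) * ln ((real n * p + 1) / \<delta>) / (real n * p))
             + 2 / 3 * (ln (1 / \<delta>) / (real n * p))} \<ge> 1 - \<delta>)"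

proof -
  let ?d = "CARD('d)"
  have P: "prob_space P" "sets P = sets borel" by fact+
  interpret M: prob_space M by fact
  have n: "n \<ge> 1" by fact
  have rv: "X i \<in> measurable M borel" if "i \<in> {1..n}" for i
    using assms(6) that by (auto simp: M.indep_vars_def)
  have ind: "M.indep_vars (\<lambda>_. P) X {1..n}"
    using assms(6) by (simp add: M.indep_vars_def P(2) cong: measurable_cong_sets)
  have law: "distr M P (X i) = P" if "i \<in> {1..n}" for i
    using assms(7)[OF that] distr_cong[OF refl P(2), of M "X i" "X i"] by simp
  show ?thesis
  proof (intro conjI impI allI)
    assume a: "\<delta> ^ (2 * ?d - 1) \<le> 1 / (17 * exp 8) \<and> n \<ge> 4"
    let ?e = "sqrt (real ?d * ln (real n / \<delta>) / real n)"
    obtain A :: "nat \<Rightarrow> (real^'d) set" where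
      A: "\<And>j. A j \<in> sets borel" "\<And>j. A j \<subseteq> {y. 0 \<le> norm y}" "growth_le ?d A"
      "controls_polar_depth 0 A"
      by (rule countable_cap_family[where 'd = 'd and t = 0]) blast
    have "M.prob {\<omega>\<in>space M. \<exists>j. n * ?e < \<bar>hits {1..n} (A j) (\<lambda>i. X i \<omega>) - n * measure P (A j)\<bar>} < \<delta>"
      by (rule M.prob_uniform_deviation_lt[OF P(1) ind law])
        (use a A(1,3) P(2) assms(1,8,9) in auto)
    moreover have "UNIV - {0 :: real^'d} \<noteq> {}"
    proof -
      have "axis undefined 1 \<in> UNIV - {0 :: real^'d}" by (simp add: axis_eq_0_iff)
      then show ?thesis by blast
    qed
    then have "1 - M.prob {\<omega>\<in>space M. \<exists>j. n * ?e < \<bar>hits {1..n} (A j) (\<lambda>i. X i \<omega>) - n * measure P (A j)\<bar>}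
      \<le> M.prob {\<omega>\<in>space M. (SUP x\<in>UNIV - {0}.
        \<bar>polar_depth (empirical_measure n (\<lambda>i. X i \<omega>)) x - polar_depth P x\<bar>) \<le> ?e}"
      by (intro M.sup_polar_depth_deviation[OF P n rv _ _ _ A(1,4)]) auto
    ultimately show "measure M {\<omega> \<in> space M.
        (SUP x\<in>UNIV - {0}. \<bar>polar_depth (empirical_measure n (\<lambda>i. X i \<omega>)) x - polar_depth P x\<bar>)
          \<le> ?e} > 1 - \<delta>"
      by linarith
  next
    fix t p :: real
    assume a: "0 < t \<and> p = measure P {y. norm y \<ge> t} \<and> 0 < p \<and> (2 * \<delta>) ^ ?d \<le> 1 / 8"
    define m where "m = real n * p"
    define c where "c = p * (3 * sqrt (real ?d * ln ((real n * p + 1) / \<delta>) / (real n * p))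
             + 2 / 3 * (ln (1 / \<delta>) / (real n * p)))"
    have p: "p > 0" and m: "m > 0" using a n by (auto simp: m_def)
    \<comment> \<open>In terms of counts the claimed error is \<open>3 * R + 2 / 3 * l\<close> in
      the notation of the numerical estimates.\<close>
    have "n * c = 3 * (m * sqrt (?d * ln ((m + 1) / \<delta>) / m)) + 2 / 3 * ln (1 / \<delta>)"
      using m n p unfolding c_def m_def by (simp add: algebra_simps)
    also have "m * sqrt (?d * ln ((m + 1) / \<delta>) / m) = sqrt (?d * ln ((m + 1) / \<delta>) * m)"
    proof -
      have "m * sqrt (z / m) = sqrt (z * m)" for z
        using m real_sqrt_mult[of "m\<^sup>2" "z / m"] by (simp add: power2_eq_square mult.commute)
      then show ?thesis .
    qed
    finally have nc: "n * c = 3 * sqrt (?d * ln ((m + 1) / \<delta>) * m) + 2 / 3 * ln (1 / \<delta>)" .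
    have "\<delta> ^ ?d \<le> 1 / 32"
    proof -
      \<comment> \<open>Dimension at least 2 gives \<open>2 ^ d \<ge> 4\<close>, which turns the
        bound 1/8 on \<open>(2 * \<delta>) ^ d\<close> into 1/32 for
        \<open>\<delta> ^ d\<close>.\<close>
      have "(2 :: real) ^ 2 \<le> 2 ^ ?d" using assms(1) by (intro power_increasing) auto
      then have "4 * \<delta> ^ ?d \<le> 2 ^ ?d * \<delta> ^ ?d" using assms(8) by (intro mult_right_mono) auto
      also have "\<dots> \<le> 1 / 8" using a by (simp add: power_mult_distrib)
      finally show ?thesis by simp
    qed
    obtain A :: "nat \<Rightarrow> (real^'d) set" where
      A: "\<And>j. A j \<in> sets borel" "\<And>j. A j \<subseteq> {y. t \<le> norm y}" "growth_le ?d A"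
      "controls_polar_depth t A"
      by (rule countable_cap_family[where 'd = 'd and t = t]) blast
    have T: "closed {y :: real^'d. t \<le> norm y}" by (intro closed_Collect_le continuous_intros)
    have "M.prob {\<omega>\<in>space M. \<exists>j. n * c < \<bar>hits {1..n} (A j) (\<lambda>i. X i \<omega>) - n * measure P (A j)\<bar>} \<le> \<delta>"
      unfolding nc m_def using a
      by (intro M.prob_tail_deviation_le[OF P(1) ind law, of n "{y. t \<le> norm y}", folded conjunct1[OF conjunct2[OF a]]])
        (use borel_closed[OF T] A P(2) n assms(1,8,9) \<open>\<delta> ^ ?d \<le> 1 / 32\<close> p in auto)
    moreover have D: "{x :: real^'d. t \<le> norm x} - {0} = {x. norm x \<ge> t}" using a by auto
    have "t *\<^sub>R axis undefined 1 \<in> {x :: real^'d. norm x \<ge> t}" using a by simp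
    then have "{x :: real^'d. t \<le> norm x} - {0} \<noteq> {}" unfolding D by blast
    then have "1 - M.prob {\<omega>\<in>space M. \<exists>j. n * c < \<bar>hits {1..n} (A j) (\<lambda>i. X i \<omega>) - n * measure P (A j)\<bar>}
      \<le> M.prob {\<omega>\<in>space M. (SUP x\<in>{x. t \<le> norm x} - {0}.
        \<bar>polar_depth (empirical_measure n (\<lambda>i. X i \<omega>)) x - polar_depth P x\<bar>) \<le> c}"
      by (intro M.sup_polar_depth_deviation[OF P n rv T _ _ A(1,4)]) auto
    moreover have "1 / p * z \<le> 3 * sqrt (real ?d * ln ((real n * p + 1) / \<delta>) / (real n * p))
             + 2 / 3 * (ln (1 / \<delta>) / (real n * p)) \<longleftrightarrow> z \<le> c" for z
      unfolding c_def using p by (simp add: pos_divide_le_eq mult.commute)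
    ultimately show "measure M {\<omega> \<in> space M.
        (1 / p) *
        (SUP x\<in>{x. norm x \<ge> t}. \<bar>polar_depth (empirical_measure n (\<lambda>i. X i \<omega>)) x - polar_depth P x\<bar>)
          \<le> 3 * sqrt (real CARD('d) * ln ((real n * p + 1) / \<delta>) / (real n * p))
             + 2 / 3 * (ln (1 / \<delta>) / (real n * p))} \<ge> 1 - \<delta>"
      unfolding D by simp
  qed
qed

end
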